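(* Let $k\ge0$ be a fixed integer, $\mathcal E$ a finite-dimensional Hilbert space and $\theta\in B(\mathcal E,F^2(H_n)\otimes\mathcal E)$. The following are equivalent: (i) $\theta$ is outer; (ii) $\theta(0)$ is invertible and for every $\psi\in B(\mathcal E,F^2(H_n)\otimes\mathcal E)$ with $K_\psi=K_\theta$, $\|\mathbb P_kM_\psi p\|\le\|\mathbb P_kM_\theta p\|$ for all $p\in\mathcal P_k(\mathcal E)$; (iii) $\theta(0)$ is invertible and $\Delta_{K_\theta}=\theta(0)^*\theta(0)$; (iv) $\theta(0)$ is invertible and $e(K_\theta)=\ln\det[\theta(0)^*\theta(0)]$. In particular, $f\in F^2(H_n)$ is outer if and only if $f(0)\ne0$ and $e(K_f)=\ln|f(0)|^2$.
   Context: Full Fock space $F^2(H_n)$, basis $e_\alpha$ ($\alpha\in\mathbb F_n^+$, identity $g_0$, $e_{g_0}=1$), $S_i\psi=e_i\otimes\psi$, $S_\alpha$ products. $\mathcal E\equiv1\otimes\mathcal E$, and $\theta(0)=P_{\mathcal E}\theta\in B(\mathcal E)$. $\theta$ is outer if $\bigvee_\alpha(S_\alpha\otimes I)\theta\mathcal E=F^2(H_n)\otimes\mathcal E$. $M_\theta$ denotes the map on polynomials $M_\theta(\sum_{|\alpha|\le m}e_\alpha\otimes h_\alpha)=\sum(S_\alpha\otimes I)\theta h_\alpha$. $K_\theta(\sigma,\omega)\in B(\mathcal E)$ is defined by $\langle K_\theta(\sigma,\omega)h,h'\rangle=\langle(S_\omega\otimes I)\theta h,(S_\sigma\otimes I)\theta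 h'\rangle$. $\mathcal P_k(\mathcal E)=\bigoplus_{|\alpha|\le k}e_\alpha\otimes\mathcal E$ and $\mathbb P_k$ is the orthogonal projection onto it. For a kernel $K$, $\langle\Delta_Kh,h\rangle=\inf\sum_{\sigma,\omega}\langle K(\omega,\sigma)h_\sigma,h_\omega\rangle$ over finitely supported $\{h_\sigma\}\subset\mathcal E$ with $h_{g_0}=h$, and $e(K)=\ln\det\Delta_K$. For $f\in F^2(H_n)$ (case $\mathcal E=\mathbb C$), $f(0)=\langle f,1\rangle$. *)

theory Defs
  imports "HOL-Analysis.Analysis"
begin

text \<open>Free semigroup on n generators: words are lists over the letters 0..n-1
  (letter i stands for generator g_(i+1)); the empty word is g_0.
  The finite-dimensional Hilbert space E is complex^'m; F^2(H_n) tensor E is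
  identified with square-summable functions  nat list => complex^'m  supported on words.\<close>

definition Wds :: "nat \<Rightarrow> nat list set" where
  "Wds n = {\<alpha>. set \<alpha> \<subseteq> {..<n}}"

definition cinner :: "complex^'m \<Rightarrow> complex^'m \<Rightarrow> complex" where
  "cinner x y = (\<Sum>i\<in>UNIV. x$i * cnj (y$i))"

definition cadj :: "complex^'m^'m \<Rightarrow> complex^'m^'m" where
  "cadj A = transpose (\<chi> i j. cnj (A$i$j))"

definition in_FE :: "nat \<Rightarrow> (nat list \<Rightarrow> complex^'m) \<Rightarrow> bool" where
  "in_FE n v \<longleftrightarrow> (\<forall>\<alpha>. \<alpha> \<notin> Wds n \<longrightarrow> v \<alpha> = 0) \<and> (\<lambda>\<alpha>. (norm (v \<alpha>))^2) summable_on UNIV"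

definition in_F2 :: "nat \<Rightarrow> (nat list \<Rightarrow> complex) \<Rightarrow> bool" where
  "in_F2 n f \<longleftrightarrow> (\<forall>\<alpha>. \<alpha> \<notin> Wds n \<longrightarrow> f \<alpha> = 0) \<and> (\<lambda>\<alpha>. (cmod (f \<alpha>))^2) summable_on UNIV"

text \<open>An operator theta in B(E, F^2(H_n) tensor E) is given by its coefficients
  theta_alpha in B(E):  theta h = sum_alpha e_alpha tensor theta_alpha h.
  Boundedness is equivalent to square-summability of the Hilbert-Schmidt norms.\<close>
definition is_op :: "nat \<Rightarrow> (nat list \<Rightarrow> complex^'m^'m) \<Rightarrow> bool" where
  "is_op n T \<longleftrightarrow> (\<forall>\<alpha>. \<alpha> \<notin> Wds n \<longrightarrow> T \<alpha> = 0) \<and> (\<lambda>\<alpha>. (norm (T \<alpha>))^2) summable_on UNIV"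

definition theta_app :: "(nat list \<Rightarrow> complex^'m^'m) \<Rightarrow> complex^'m \<Rightarrow> nat list \<Rightarrow> complex^'m" where
  "theta_app T h = (\<lambda>\<alpha>. T \<alpha> *v h)"

text \<open>(S_omega tensor I) v; S_omega e_beta = e_(omega beta).\<close>
definition shiftS :: "nat list \<Rightarrow> (nat list \<Rightarrow> 'a::zero) \<Rightarrow> nat list \<Rightarrow> 'a" where
  "shiftS \<omega> v \<beta> = (if take (length \<omega>) \<beta> = \<omega> then v (drop (length \<omega>) \<beta>) else 0)"

definition l2inner :: "(nat list \<Rightarrow> complex^'m) \<Rightarrow> (nat list \<Rightarrow> complex^'m) \<Rightarrow> complex" where
  "l2inner u v = infsum (\<lambda>\<alpha>. cinner (u \<alpha>) (v \<alpha>)) UNIV"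

definition l2norm :: "(nat list \<Rightarrow> complex^'m) \<Rightarrow> real" where
  "l2norm v = sqrt (infsum (\<lambda>\<alpha>. (norm (v \<alpha>))^2) UNIV)"

definition is_poly :: "nat \<Rightarrow> (nat list \<Rightarrow> complex^'m) \<Rightarrow> bool" where
  "is_poly n hp \<longleftrightarrow> finite {\<alpha>. hp \<alpha> \<noteq> 0} \<and> {\<alpha>. hp \<alpha> \<noteq> 0} \<subseteq> Wds n"

definition in_Pk :: "nat \<Rightarrow> nat \<Rightarrow> (nat list \<Rightarrow> complex^'m) \<Rightarrow> bool" where
  "in_Pk n k hp \<longleftrightarrow> (\<forall>\<alpha>. hp \<alpha> \<noteq> 0 \<longrightarrow> \<alpha> \<in> Wds n \<and> length \<alpha> \<le> k)"

definition Mpoly :: "(nat list \<Rightarrow> complex^'m^'m) \<Rightarrow> (nat list \<Rightarrow> complex^'m) \<Rightarrow> nat list \<Rightarrow> complex^'m" where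
  "Mpoly T hp = (\<lambda>\<beta>. \<Sum>\<alpha>\<in>{\<alpha>. hp \<alpha> \<noteq> 0}. shiftS \<alpha> (theta_app T (hp \<alpha>)) \<beta>)"

definition Pk :: "nat \<Rightarrow> (nat list \<Rightarrow> complex^'m) \<Rightarrow> nat list \<Rightarrow> complex^'m" where
  "Pk k v = (\<lambda>\<beta>. if length \<beta> \<le> k then v \<beta> else 0)"

text \<open>theta is outer: the closed span of (S_alpha tensor I) theta E, i.e. the closure
  of M_theta(polynomials), is all of F^2(H_n) tensor E.\<close>
definition outer :: "nat \<Rightarrow> (nat list \<Rightarrow> complex^'m^'m) \<Rightarrow> bool" where
  "outer n T \<longleftrightarrow> (\<forall>v. in_FE n v \<longrightarrow>
     (\<forall>\<epsilon>>0. \<exists>hp. is_poly n hp \<and> l2norm (\<lambda>\<beta>. v \<beta> - Mpoly T hp \<beta>) < \<epsilon>))"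

text \<open>Kernel K_theta(sigma,omega) as a matrix:
  <K h, h'> = <(S_omega tensor I) theta h, (S_sigma tensor I) theta h'>.\<close>
definition kernel :: "(nat list \<Rightarrow> complex^'m^'m) \<Rightarrow> nat list \<Rightarrow> nat list \<Rightarrow> complex^'m^'m" where
  "kernel T \<sigma> \<omega> = (\<chi> i j. l2inner (shiftS \<omega> (theta_app T (axis j 1))) (shiftS \<sigma> (theta_app T (axis i 1))))"

definition Delta_form :: "nat \<Rightarrow> (nat list \<Rightarrow> nat list \<Rightarrow> complex^'m^'m) \<Rightarrow> complex^'m \<Rightarrow> real" where
  "Delta_form n K h = Inf {x. \<exists>F hs. finite F \<and> F \<subseteq> Wds n \<and> (\<forall>\<sigma>. \<sigma> \<notin> F \<longrightarrow> hs \<sigma> = 0)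
      \<and> hs [] = h \<and> x = Re (\<Sum>\<sigma>\<in>F. \<Sum>\<omega>\<in>F. cinner (K \<omega> \<sigma> *v hs \<sigma>) (hs \<omega>))}"

definition Delta :: "nat \<Rightarrow> (nat list \<Rightarrow> nat list \<Rightarrow> complex^'m^'m) \<Rightarrow> complex^'m^'m" where
  "Delta n K = (THE D. \<forall>h. cinner (D *v h) h = complex_of_real (Delta_form n K h))"

definition eK :: "nat \<Rightarrow> (nat list \<Rightarrow> nat list \<Rightarrow> complex^'m^'m) \<Rightarrow> ereal" where
  "eK n K = (if Re (det (Delta n K)) > 0 then ereal (ln (Re (det (Delta n K)))) else -\<infinity>)"

definition scal :: "(nat list \<Rightarrow> complex) \<Rightarrow> nat list \<Rightarrow> complex^1^1" where
  "scal f = (\<lambda>\<alpha>. \<chi> i j. f \<alpha>)"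

end

theory Submission
  imports Defs "HOL-Computational_Algebra.Fundamental_Theorem_Algebra"
begin

text \<open>Let \<open>N\<^sub>1\<close> be the closed span of the \<open>S\<^sub>\<alpha> \<theta> \<E>\<close> with \<open>\<alpha>\<close> nonempty and \<open>L h\<close> the component of \<open>\<theta> h\<close>
  orthogonal to \<open>N\<^sub>1\<close>. Then \<open>\<langle>\<Delta> h, h\<rangle> = \<parallel>L h\<parallel>\<^sup>2\<close>, the vacuum coefficient of \<open>L h\<close> is \<open>\<theta>(0) h\<close>, hence
  \<open>\<Delta> \<ge> \<theta>(0)\<^sup>*\<theta>(0)\<close>, and equality means that \<open>L h = 1 \<otimes> \<theta>(0) h\<close>, i.e. that the vacuum vectors lie in
  the invariant subspace generated by \<open>\<theta>\<close>. Strict monotonicity of the determinant turns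
  this into the entropy condition. If \<open>\<theta>\<close> is outer, the images of the polynomials of order greater than
  \<open>k\<close> are dense in the complement of \<open>\<P>\<^sub>k(\<E>)\<close>, so \<open>\<parallel>P\<^sub>k M\<^sub>\<theta> p\<parallel>\<close> is a distance that depends on \<open>K\<^sub>\<theta>\<close> only and
  dominates the corresponding quantity for any \<open>\<psi>\<close> with the same kernel. Conversely, the Wold decomposition
  of the invariant subspace generated by \<open>\<theta>\<close> provides a \<open>\<psi>\<close> with \<open>K\<^sub>\<psi> = K\<^sub>\<theta>\<close> and
  \<open>\<parallel>\<psi>(0) h\<parallel> \<ge> \<parallel>L h\<parallel>\<close>; testing maximality on \<open>e\<^sub>\<alpha> \<otimes> h\<close> with \<open>|\<alpha>| = k\<close> gives \<open>\<parallel>L h\<parallel> \<le> \<parallel>\<theta>(0) h\<parallel>\<close>.\<close>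

section \<open>Square-summable families\<close>

typedef (overloaded) ('a, 'b::real_inner) ell2 =
  "{v :: 'a \<Rightarrow> 'b. (\<lambda>x. (norm (v x))\<^sup>2) summable_on UNIV}"
  morphisms coord Abs_ell2
  by (rule exI [of _ "\<lambda>_. 0"]) simp

setup_lifting type_definition_ell2

lemma coord_sq_summable: "(\<lambda>x. (norm (coord u x))\<^sup>2) summable_on UNIV"
  using coord [of u] by simp

lemma sq_summable_add:
  fixes u v :: "'a \<Rightarrow> 'b::real_inner"
  assumes "(\<lambda>x. (norm (u x))\<^sup>2) summable_on UNIV" "(\<lambda>x. (norm (v x))\<^sup>2) summable_on UNIV"
  shows "(\<lambda>x. (norm (u x + v x))\<^sup>2) summable_on UNIV"
proof (rule summable_on_comparison_test)
  show "(\<lambda>x. 2 * (norm (u x))\<^sup>2 + 2 * (norm (v x))\<^sup>2) summable_on UNIV"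
    by (intro summable_on_add summable_on_cmult_right assms)
  fix x
  have "(norm (u x + v x))\<^sup>2 \<le> (norm (u x) + norm (v x))\<^sup>2"
    by (intro power_mono norm_triangle_ineq) auto
  also have "\<dots> \<le> 2 * (norm (u x))\<^sup>2 + 2 * (norm (v x))\<^sup>2"
    using sum_squares_bound [of "norm (u x)" "norm (v x)"] by (simp add: power2_sum)
  finally show "(norm (u x + v x))\<^sup>2 \<le> 2 * (norm (u x))\<^sup>2 + 2 * (norm (v x))\<^sup>2" .
qed auto

lemma sq_summable_inner:
  fixes u v :: "'a \<Rightarrow> 'b::real_inner"
  assumes "(\<lambda>x. (norm (u x))\<^sup>2) summable_on UNIV" "(\<lambda>x. (norm (v x))\<^sup>2) summable_on UNIV"
  shows "(\<lambda>x. inner (u x) (v x)) summable_on UNIV"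
proof (rule abs_summable_summable, rule summable_on_comparison_test)
  show "(\<lambda>x. (norm (u x))\<^sup>2 + (norm (v x))\<^sup>2) summable_on UNIV"
    by (intro summable_on_add assms)
  fix x
  have "norm (inner (u x) (v x)) \<le> norm (u x) * norm (v x)"
    by (simp add: Cauchy_Schwarz_ineq2)
  also have "\<dots> \<le> (norm (u x))\<^sup>2 + (norm (v x))\<^sup>2"
    using sum_squares_bound [of "norm (u x)" "norm (v x)"]
      zero_le_mult_iff[of "norm (u x)" "norm (v x)"] norm_ge_zero[of "u x"] norm_ge_zero[of "v x"] by linarith
  finally show "norm (inner (u x) (v x)) \<le> (norm (u x))\<^sup>2 + (norm (v x))\<^sup>2" .
qed auto

instantiation ell2 :: (type, real_inner) real_vector
begin

lift_definition zero_ell2 :: "('a, 'b) ell2" is "\<lambda>_. 0" by simp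
lift_definition plus_ell2 :: "('a, 'b) ell2 \<Rightarrow> ('a, 'b) ell2 \<Rightarrow> ('a, 'b) ell2"
  is "\<lambda>u v x. u x + v x" by (rule sq_summable_add)
lift_definition uminus_ell2 :: "('a, 'b) ell2 \<Rightarrow> ('a, 'b) ell2"
  is "\<lambda>u x. - u x" by simp
lift_definition minus_ell2 :: "('a, 'b) ell2 \<Rightarrow> ('a, 'b) ell2 \<Rightarrow> ('a, 'b) ell2"
  is "\<lambda>u v x. u x - v x"
  using sq_summable_add [of _ "\<lambda>x. - _ x"] by simp
lift_definition scaleR_ell2 :: "real \<Rightarrow> ('a, 'b) ell2 \<Rightarrow> ('a, 'b) ell2"
  is "\<lambda>r u x. r *\<^sub>R u x"
  by (simp add: power_mult_distrib summable_on_cmult_right)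

instance
  by standard (transfer; simp add: algebra_simps)+

end

lemmas coord_simps [simp] =
  zero_ell2.rep_eq plus_ell2.rep_eq minus_ell2.rep_eq uminus_ell2.rep_eq scaleR_ell2.rep_eq

lemma coord_sum [simp]: "coord (\<Sum>i\<in>I. f i) x = (\<Sum>i\<in>I. coord (f i) x)"
  by (induction I rule: infinite_finite_induct) auto

lemma ell2_eqI: "(\<And>x. coord u x = coord v x) \<Longrightarrow> u = v"
  by (simp add: coord_inject [symmetric] ext)

lemma coord_Abs: "(\<lambda>x. (norm (v x))\<^sup>2) summable_on UNIV \<Longrightarrow> coord (Abs_ell2 v) = v"
  by (simp add: Abs_ell2_inverse)

instantiation ell2 :: (type, real_inner) real_inner
begin

definition inner_ell2 :: "('a, 'b) ell2 \<Rightarrow> ('a, 'b) ell2 \<Rightarrow> real" where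
  "inner u v = infsum (\<lambda>x. inner (coord u x) (coord v x)) UNIV"
definition norm_ell2 :: "('a, 'b) ell2 \<Rightarrow> real" where
  "norm_ell2 u = sqrt (inner u u)"
definition dist_ell2 :: "('a, 'b) ell2 \<Rightarrow> ('a, 'b) ell2 \<Rightarrow> real" where
  "dist_ell2 u v = sqrt (inner (u - v) (u - v))"
definition sgn_ell2 :: "('a, 'b) ell2 \<Rightarrow> ('a, 'b) ell2" where
  "sgn_ell2 u = u /\<^sub>R sqrt (inner u u)"
definition uniformity_ell2 :: "(('a, 'b) ell2 \<times> ('a, 'b) ell2) filter" where
  "uniformity_ell2 = (INF e\<in>{0<..}. principal {(u, v). sqrt (inner (u - v) (u - v)) < e})"
definition open_ell2 :: "('a, 'b) ell2 set \<Rightarrow> bool" where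
  "open_ell2 U \<longleftrightarrow> (\<forall>u\<in>U. eventually (\<lambda>(u', v). u' = u \<longrightarrow> v \<in> U)
      (INF e\<in>{0<..}. principal {(u, v). sqrt (inner (u - v) (u - v)) < e}))"

instance
proof
  fix u v w :: "('a, 'b) ell2" and r :: real
  have summ: "(\<lambda>x. inner (coord u x) (coord v x)) summable_on UNIV" for u v :: "('a, 'b) ell2"
    by (intro sq_summable_inner coord_sq_summable)
  show "inner u v = inner v u"
    by (simp add: inner_ell2_def inner_commute)
  show "inner (u + v) w = inner u w + inner v w"
    by (simp add: inner_ell2_def inner_add_left infsum_add summ)
  show "inner (r *\<^sub>R u) v = r * inner u v"
    by (simp add: inner_ell2_def infsum_cmult_right summ)
  show "0 \<le> inner u u"
    by (simp add: inner_ell2_def infsum_nonneg)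
  show "inner u u = 0 \<longleftrightarrow> u = 0"
  proof
    assume *: "inner u u = 0"
    have "inner (coord u x) (coord u x) = 0" for x
      using * by (intro nonneg_infsum_le_0D [OF _ summ [of u u]]) (auto simp: inner_ell2_def)
    thus "u = 0" by (intro ell2_eqI) simp
  qed (simp add: inner_ell2_def)
qed (simp_all add: norm_ell2_def dist_ell2_def sgn_ell2_def uniformity_ell2_def open_ell2_def)

end

lemma ell2_norm_sq: "(norm u)\<^sup>2 = infsum (\<lambda>x. (norm (coord u x))\<^sup>2) UNIV"
  by (simp add: power2_norm_eq_inner inner_ell2_def)

lemma sum_le_ell2_norm_sq: "finite F \<Longrightarrow> (\<Sum>x\<in>F. (norm (coord u x))\<^sup>2) \<le> (norm u)\<^sup>2"
  unfolding ell2_norm_sq by (intro finite_sum_le_infsum coord_sq_summable) auto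

lemma norm_coord_le: "norm (coord u x) \<le> norm u"
  using sum_le_ell2_norm_sq [of "{x}" u] by (auto intro: power2_le_imp_le)

lemma ell2_norm_sq_le:
  assumes "\<And>F. finite F \<Longrightarrow> (\<Sum>x\<in>F. (norm (coord u x))\<^sup>2) \<le> b"
  shows "(norm u)\<^sup>2 \<le> b"
  unfolding ell2_norm_sq by (intro infsum_le_finite_sums coord_sq_summable assms)

lemma ell2_orthogonal_if_disjoint:
  "(\<And>x. coord u x = 0 \<or> coord v x = 0) \<Longrightarrow> inner u v = 0"
  unfolding inner_ell2_def by (intro infsum_0) (metis inner_zero_left inner_zero_right)

lemma tendsto_coord:
  assumes "(f \<longlongrightarrow> u) F" shows "((\<lambda>i. coord (f i) x) \<longlongrightarrow> coord u x) F"
proof (rule Lim_transform_bound [OF _ assms [THEN LIM_zero], THEN LIM_zero_cancel])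
  show "\<forall>\<^sub>F i in F. norm (coord (f i) x - coord u x) \<le> norm (f i - u)"
    using norm_coord_le [of "_ - u" x] by simp
qed

instance ell2 :: (type, "{real_inner, complete_space}") complete_space
proof
  fix X :: "nat \<Rightarrow> ('a, 'b) ell2"
  assume X: "Cauchy X"
  have "Cauchy (\<lambda>n. coord (X n) x)" for x
  proof (rule metric_CauchyI)
    fix e :: real assume "e > 0"
    then obtain M where M: "\<And>m n. m \<ge> M \<Longrightarrow> n \<ge> M \<Longrightarrow> dist (X m) (X n) < e"
      using X by (metis metric_CauchyD)
    have "dist (coord (X m) x) (coord (X n) x) < e" if "m \<ge> M" "n \<ge> M" for m n
      using norm_coord_le [of "X m - X n" x] M [OF that] by (simp add: dist_norm)
    thus "\<exists>M. \<forall>m\<ge>M. \<forall>n\<ge>M. dist (coord (X m) x) (coord (X n) x) < e" by blast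
  qed
  hence "\<forall>x. \<exists>l. (\<lambda>n. coord (X n) x) \<longlonglongrightarrow> l"
    using Cauchy_convergent convergent_def by blast
  then obtain v where v: "\<And>x. (\<lambda>n. coord (X n) x) \<longlonglongrightarrow> v x"
    by metis
  have *: "\<exists>M. \<forall>m\<ge>M. \<forall>F. finite F \<longrightarrow> (\<Sum>x\<in>F. (norm (coord (X m) x - v x))\<^sup>2) \<le> e\<^sup>2"
    if e: "e > 0" for e
  proof -
    obtain M where M: "\<And>m n. m \<ge> M \<Longrightarrow> n \<ge> M \<Longrightarrow> dist (X m) (X n) < e"
      using X e by (metis metric_CauchyD)
    have "(\<Sum>x\<in>F. (norm (coord (X m) x - v x))\<^sup>2) \<le> e\<^sup>2" if F: "finite F" and m: "m \<ge> M" for F m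
    proof (rule tendsto_upperbound)
      show "(\<lambda>n. \<Sum>x\<in>F. (norm (coord (X m) x - coord (X n) x))\<^sup>2) \<longlonglongrightarrow> (\<Sum>x\<in>F. (norm (coord (X m) x - v x))\<^sup>2)"
        by (intro tendsto_intros v)
      have "(\<Sum>x\<in>F. (norm (coord (X m) x - coord (X n) x))\<^sup>2) \<le> e\<^sup>2" if "n \<ge> M" for n
      proof -
        have "(\<Sum>x\<in>F. (norm (coord (X m) x - coord (X n) x))\<^sup>2) \<le> (norm (X m - X n))\<^sup>2"
          using sum_le_ell2_norm_sq [OF F, of "X m - X n"] by simp
        also have "\<dots> \<le> e\<^sup>2"
          using M [OF m that] by (intro power_mono) (auto simp: dist_norm)
        finally show ?thesis .
      qed
      thus "\<forall>\<^sub>F n in sequentially. (\<Sum>x\<in>F. (norm (coord (X m) x - coord (X n) x))\<^sup>2) \<le> e\<^sup>2"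
        using eventually_sequentially by blast
    qed auto
    thus ?thesis by blast
  qed
  have diff: "(\<lambda>x. (norm (coord (X m) x - v x))\<^sup>2) summable_on UNIV"
    if "\<forall>F. finite F \<longrightarrow> (\<Sum>x\<in>F. (norm (coord (X m) x - v x))\<^sup>2) \<le> b" for m b
    using that by (intro nonneg_bdd_above_summable_on bdd_aboveI2 [where M=b]) auto
  obtain m where "\<forall>F. finite F \<longrightarrow> (\<Sum>x\<in>F. (norm (coord (X m) x - v x))\<^sup>2) \<le> 1\<^sup>2"
    using * [of 1] by auto
  from sq_summable_add [OF coord_sq_summable [of "- X m"] diff [OF this]]
  have vs: "(\<lambda>x. (norm (v x))\<^sup>2) summable_on UNIV" by (simp add: norm_minus_commute)
  define V where "V = Abs_ell2 v"
  have V: "coord V = v" using vs by (simp add: V_def coord_Abs)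
  have "X \<longlonglongrightarrow> V"
  proof (rule LIMSEQ_I)
    fix e :: real assume "e > 0"
    then obtain M where M: "\<forall>m\<ge>M. \<forall>F. finite F \<longrightarrow> (\<Sum>x\<in>F. (norm (coord (X m) x - v x))\<^sup>2) \<le> (e/2)\<^sup>2"
      using * [of "e/2"] by auto
    have "norm (X m - V) < e" if "m \<ge> M" for m
    proof -
      have "(norm (X m - V))\<^sup>2 \<le> (e/2)\<^sup>2"
        using M that V by (intro ell2_norm_sq_le) auto
      from power2_le_imp_le [OF this] have "norm (X m - V) \<le> e/2" using \<open>e > 0\<close> by linarith
      thus ?thesis using \<open>e > 0\<close> by linarith
    qed
    thus "\<exists>M. \<forall>m\<ge>M. norm (X m - V) < e" by blast
  qed
  thus "convergent X" by (auto simp: convergent_def)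
qed

text \<open>A minimizing sequence is Cauchy by the parallelogram law.\<close>

lemma ex_orthogonal_projection:
  fixes S :: "'a::{real_inner, complete_space} set"
  assumes S: "subspace S"
  shows "\<exists>y\<in>closure S. \<forall>s\<in>S. inner (x - y) s = 0"
proof -
  define d where "d = (INF s\<in>S. (norm (x - s))\<^sup>2)"
  have bdd: "bdd_below ((\<lambda>s. (norm (x - s))\<^sup>2) ` S)" by (rule bdd_belowI2 [where m=0]) auto
  have S0: "S \<noteq> {}" using subspace_0 [OF S] by blast
  have dle: "d \<le> (norm (x - s))\<^sup>2" if "s \<in> S" for s
    unfolding d_def using bdd that by (rule cINF_lower)
  have "\<exists>s\<in>S. (norm (x - s))\<^sup>2 < d + 1 / real (Suc n)" for n
  proof (rule ccontr)
    assume "\<not> ?thesis"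
    hence "d + 1 / real (Suc n) \<le> d"
      unfolding d_def by (intro cINF_greatest S0) (auto simp: not_less)
    thus False by (simp add: field_simps)
  qed
  then obtain s where sS: "\<And>n. s n \<in> S" and s: "\<And>n. (norm (x - s n))\<^sup>2 < d + 1 / real (Suc n)"
    by metis
  have par: "(norm (s m - s n))\<^sup>2 \<le> 2 / real (Suc m) + 2 / real (Suc n)" for m n
  proof -
    have "(1/2) *\<^sub>R (s m + s n) \<in> S"
      using S sS by (intro subspace_scale subspace_add) auto
    from dle [OF this] have "4 * d \<le> (2 * norm (x - (1/2) *\<^sub>R (s m + s n)))\<^sup>2"
      by (simp add: power_mult_distrib)
    also have "2 * norm (x - (1/2) *\<^sub>R (s m + s n)) = norm (2 *\<^sub>R (x - (1/2) *\<^sub>R (s m + s n)))"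
      by simp
    also have "2 *\<^sub>R (x - (1/2) *\<^sub>R (s m + s n)) = (x - s m) + (x - s n)"
      by (simp add: algebra_simps scaleR_2)
    finally have "4 * d \<le> (norm ((x - s m) + (x - s n)))\<^sup>2" .
    moreover have "(norm ((x - s m) + (x - s n)))\<^sup>2 + (norm (s m - s n))\<^sup>2
        = 2 * (norm (x - s m))\<^sup>2 + 2 * (norm (x - s n))\<^sup>2"
      unfolding power2_norm_eq_inner by (simp add: algebra_simps inner_commute)
    ultimately show ?thesis using s [of m] s [of n] by simp
  qed
  have "Cauchy s"
  proof (rule metric_CauchyI)
    fix e :: real assume e: "e > 0"
    then obtain N where N: "inverse (real (Suc N)) < e\<^sup>2 / 4"
      using reals_Archimedean [of "e\<^sup>2/4"] by auto
    have "dist (s m) (s n) < e" if "m \<ge> N" "n \<ge> N" for m n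
    proof -
      have "2 / real (Suc m) \<le> 2 * inverse (real (Suc N))" "2 / real (Suc n) \<le> 2 * inverse (real (Suc N))"
        using that by (auto simp: field_simps)
      hence "(norm (s m - s n))\<^sup>2 < e\<^sup>2" using par [of m n] N by linarith
      thus ?thesis using e by (simp add: dist_norm power2_less_imp_less)
    qed
    thus "\<exists>M. \<forall>m\<ge>M. \<forall>n\<ge>M. dist (s m) (s n) < e" by blast
  qed
  then obtain y where y: "s \<longlonglongrightarrow> y" by (metis Cauchy_convergent convergent_def)
  have ycl: "y \<in> closure S" using y sS by (metis closure_sequential)
  have ny: "(norm (x - y))\<^sup>2 \<le> d"
  proof (rule LIMSEQ_le)
    show "(\<lambda>n. (norm (x - s n))\<^sup>2) \<longlonglongrightarrow> (norm (x - y))\<^sup>2" by (intro tendsto_intros y)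
    have "(\<lambda>n. d + 1 / real (Suc n)) \<longlonglongrightarrow> d + 0"
      using LIMSEQ_inverse_real_of_nat by (intro tendsto_add) (auto simp: inverse_eq_divide)
    thus "(\<lambda>n. d + 1 / real (Suc n)) \<longlonglongrightarrow> d" by simp
  qed (use s less_imp_le in blast)
  have dcl: "d \<le> (norm (x - z))\<^sup>2" if z: "z \<in> closure S" for z
  proof -
    obtain t where t: "\<And>n. t n \<in> S" "t \<longlonglongrightarrow> z" using z by (metis closure_sequential)
    show ?thesis
      by (rule LIMSEQ_le_const [of "\<lambda>n. (norm (x - t n))\<^sup>2"]) (auto intro!: tendsto_intros t dle)
  qed
  have "inner (x - y) u = 0" if u: "u \<in> S" for u
  proof (cases "u = 0")
    case False
    define c where "c = inner (x - y) u / inner u u"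
    have "(\<lambda>n. s n + c *\<^sub>R u) \<longlonglongrightarrow> y + c *\<^sub>R u" by (intro tendsto_intros y)
    hence "y + c *\<^sub>R u \<in> closure S"
      unfolding closure_sequential using S sS u
      by (intro exI [of _ "\<lambda>n. s n + c *\<^sub>R u"]) (auto intro: subspace_add subspace_scale)
    from dcl [OF this] have "(norm (x - y))\<^sup>2 \<le> (norm (x - (y + c *\<^sub>R u)))\<^sup>2" using ny by linarith
    also have "\<dots> = (norm (x - y))\<^sup>2 - 2 * c * inner (x - y) u + c\<^sup>2 * inner u u"
      unfolding power2_norm_eq_inner by (simp add: algebra_simps inner_commute power2_eq_square)
    also have "\<dots> = (norm (x - y))\<^sup>2 - (inner (x - y) u)\<^sup>2 / inner u u"
      using False by (simp add: c_def field_simps power2_eq_square)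
    finally have "(inner (x - y) u)\<^sup>2 / inner u u \<le> 0" by simp
    thus ?thesis using False by (simp add: divide_le_0_iff not_le flip: inner_gt_zero_iff)
  qed simp
  thus ?thesis using ycl by blast
qed

section \<open>Hermitian forms and determinants\<close>

lemma cinner_add_left: "cinner (x + y) z = cinner x z + cinner y z"
  by (simp add: cinner_def distrib_right sum.distrib)
lemma cinner_add_right: "cinner x (y + z) = cinner x y + cinner x z"
  by (simp add: cinner_def distrib_left sum.distrib)
lemma cinner_diff_left: "cinner (x - y) z = cinner x z - cinner y z"
  by (simp add: cinner_def left_diff_distrib sum_subtractf)
lemma cinner_diff_right: "cinner x (y - z) = cinner x y - cinner x z"
  by (simp add: cinner_def right_diff_distrib sum_subtractf)
lemma cinner_scale_left: "cinner (c *s x) y = c * cinner x y"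
  by (simp add: cinner_def sum_distrib_left mult.assoc)
lemma cinner_scale_right: "cinner x (c *s y) = cnj c * cinner x y"
  by (simp add: cinner_def sum_distrib_left mult_ac)
lemma cinner_zero [simp]: "cinner 0 x = 0" "cinner x 0 = 0"
  by (simp_all add: cinner_def)
lemma cinner_axis_right: "cinner x (axis a 1) = x $ a"
proof -
  have "cinner x (axis a 1) = (\<Sum>i\<in>UNIV. if i = a then x $ i else 0)"
    unfolding cinner_def by (intro sum.cong) (auto simp: axis_def)
  thus ?thesis by simp
qed

lemma matrix_vector_mult_axis: "(A :: complex^'n^'m) *v axis a 1 = column a A"
  by (simp add: vec_eq_iff matrix_vector_mult_def column_def axis_def if_distrib cong: if_cong)

lemmas cinner_simps = cinner_add_left cinner_add_right cinner_diff_left cinner_diff_right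
  cinner_scale_left cinner_scale_right

lemma Re_cinner: "Re (cinner x y) = inner x y"
  by (simp add: cinner_def inner_vec_def inner_complex_def)

lemma cinner_self: "cinner x x = complex_of_real ((norm x)\<^sup>2)"
proof -
  have "Im (cinner x x) = 0" by (simp add: cinner_def mult.commute)
  thus ?thesis by (simp add: complex_eq_iff Re_cinner power2_norm_eq_inner)
qed

lemma cinner_cadj_mult: "cinner (cadj A ** B *v x) y = cinner (B *v x) (A *v y)"
proof -
  have "cinner (cadj A ** B *v x) y = (\<Sum>i\<in>UNIV. \<Sum>k\<in>UNIV. cnj (A$k$i) * (B *v x)$k * cnj (y$i))"
    by (simp add: cinner_def matrix_vector_mul_assoc [symmetric] cadj_def transpose_def
        matrix_vector_mult_def [of "\<chi> i j. cnj (A$j$i)"] sum_distrib_right)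
  also have "\<dots> = (\<Sum>k\<in>UNIV. \<Sum>i\<in>UNIV. cnj (A$k$i) * (B *v x)$k * cnj (y$i))"
    by (rule sum.swap)
  also have "\<dots> = cinner (B *v x) (A *v y)"
    by (simp add: cinner_def matrix_vector_mult_def [of A y] sum_distrib_left mult_ac)
  finally show ?thesis .
qed

lemma cinner_cadj_mult_self: "cinner (cadj A ** A *v x) x = complex_of_real ((norm (A *v x))\<^sup>2)"
  by (simp add: cinner_cadj_mult cinner_self)

lemma scaleR_eq_scale: "r *\<^sub>R x = complex_of_real r *s (x :: complex^'n)"
  by (simp add: vec_eq_iff) (simp add: scaleR_conv_of_real)

lemma hermitian_form_eq_zero:
  assumes "\<And>h. cinner (M *v h) h = 0"
  shows "M = 0"
proof -
  have "cinner (M *v x) y = 0" for x y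
  proof -
    have "cinner (M *v x) y + cinner (M *v y) x = 0"
      using assms [of "x + y"] assms [of x] assms [of y] by (simp add: cinner_simps matrix_vector_right_distrib add.commute)
    moreover have "- \<i> * cinner (M *v x) y + \<i> * cinner (M *v y) x = 0"
      using assms [of "x + \<i> *s y"] assms [of x] assms [of y]
      by (simp add: cinner_simps matrix_vector_right_distrib vector_scalar_commute add.commute)
    moreover have "2 * \<i> * a = \<i> * (a + b) - (- \<i> * a + \<i> * b)" for a b :: complex
      by (simp add: algebra_simps)
    ultimately have "2 * \<i> * cinner (M *v x) y = 0" by (metis diff_self mult_zero_right)
    thus ?thesis by simp
  qed
  hence "cinner (M *v x) (M *v x) = 0" for x by blast
  hence "M *v x = 0" for x by (simp add: cinner_self)
  thus ?thesis by (simp add: matrix_eq)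
qed

lemma hermitian_form_unique:
  assumes "\<And>h. cinner (A *v h) h = cinner (B *v h) h"
  shows "A = B"
  using hermitian_form_eq_zero [of "A - B"] assms
  by (simp add: matrix_vector_mult_diff_rdistrib cinner_diff_left)

definition psd :: "complex^'n^'n \<Rightarrow> bool" where
  "psd P \<longleftrightarrow> (\<forall>h. Im (cinner (P *v h) h) = 0 \<and> 0 \<le> Re (cinner (P *v h) h))"

lemma psd_hermitian:
  assumes "psd P" shows "cinner (P *v x) y = cnj (cinner (P *v y) x)"
proof -
  have im: "Im (cinner (P *v h) h) = 0" for h using assms by (simp add: psd_def)
  have "Im (cinner (P *v x) y + cinner (P *v y) x) = 0"
    using im [of "x + y"] im [of x] im [of y] by (simp add: cinner_simps matrix_vector_right_distrib)
  moreover have "Im (- \<i> * cinner (P *v x) y + \<i> * cinner (P *v y) x) = 0"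
    using im [of "x + \<i> *s y"] im [of x] im [of y]
    by (simp add: cinner_simps matrix_vector_right_distrib vector_scalar_commute)
  ultimately show ?thesis by (simp add: complex_eq_iff)
qed

lemma psd_null:
  assumes P: "psd P" and x: "cinner (P *v x) x = 0"
  shows "P *v x = 0"
proof -
  define y where "y = P *v x"
  define c where "c = (norm y)\<^sup>2"
  define q where "q = Re (cinner (P *v y) y)"
  have q: "q \<ge> 0" using P by (simp add: q_def psd_def)
  have yy: "Re (cinner (P *v x) y) = c" "Re (cinner (P *v y) x) = c"
    using psd_hermitian [OF P, of y x] by (auto simp: y_def c_def cinner_self)
  define t where "t = - c / (q + 1)"
  have "0 \<le> Re (cinner (P *v (x + complex_of_real t *s y)) (x + complex_of_real t *s y))"
    using P by (simp add: psd_def)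
  also have "\<dots> = 2 * t * c + t\<^sup>2 * q"
    using yy by (simp add: cinner_simps matrix_vector_right_distrib vector_scalar_commute x
        power2_eq_square q_def algebra_simps)
  finally have "0 \<le> (q + 1)\<^sup>2 * (2 * t * c + t\<^sup>2 * q)" by simp
  also have "\<dots> = 2 * (q + 1) * c * (t * (q + 1)) + q * (t * (q + 1))\<^sup>2"
    by (simp add: algebra_simps power2_eq_square)
  also have "t * (q + 1) = - c" using q by (simp add: t_def)
  finally have "c\<^sup>2 * (q + 2) \<le> 0" by (simp add: algebra_simps power2_eq_square)
  hence "c = 0" using q by (simp add: mult_le_0_iff)
  thus ?thesis by (simp add: c_def y_def)
qed

lemma det_eq_0_if_kernel:
  fixes A :: "complex^'n^'n"
  assumes "A *v x = 0" "x \<noteq> 0" shows "det A = 0"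
  using assms invertible_det_nz [of A] invertible_left_inverse [of A] matrix_left_invertible_ker [of A] by blast

lemma kernel_if_det_eq_0:
  fixes A :: "complex^'n^'n"
  assumes "det A = 0" shows "\<exists>x. x \<noteq> 0 \<and> A *v x = 0"
  using assms invertible_det_nz [of A] invertible_left_inverse [of A] matrix_left_invertible_ker [of A] by blast

text \<open>The polynomial \<open>det (B + z P)\<close> has only negative real roots, and at least one of them, coming from
  a maximizer of the generalized Rayleigh quotient of \<open>P\<close> with respect to \<open>B\<close>.\<close>

lemma det_strict_mono:
  fixes B P :: "complex^'n^'n"
  assumes B: "\<And>h. h \<noteq> 0 \<Longrightarrow> Im (cinner (B *v h) h) = 0 \<and> 0 < Re (cinner (B *v h) h)"
    and P: "psd P" and "P \<noteq> 0"
  shows "\<exists>c>1. det (B + P) = complex_of_real c * det B"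
proof -
  let ?p = "\<lambda>h. Re (cinner (P *v h) h)" and ?b = "\<lambda>h. Re (cinner (B *v h) h)"
  have Bim: "Im (cinner (B *v h) h) = 0" for h using B [of h] by (cases "h = 0") auto
  have hom: "?p (r *\<^sub>R h) = r\<^sup>2 * ?p h" "?b (r *\<^sub>R h) = r\<^sup>2 * ?b h" for r h
    by (simp_all add: scaleR_eq_scale vector_scalar_commute cinner_simps power2_eq_square)
  have cont: "continuous_on S (\<lambda>h. Re (cinner (M *v h) h))" for S and M :: "complex^'n^'n"
    unfolding cinner_def matrix_vector_mult_def by (simp add: continuous_intros)
  have sph: "h \<noteq> 0" if "h \<in> sphere 0 1" for h :: "complex^'n" using that by auto
  have "sphere 0 1 \<noteq> ({} :: (complex^'n) set)" by simp
  then obtain x0 where x0: "x0 \<in> sphere 0 1" and max: "\<And>h. h \<in> sphere 0 1 \<Longrightarrow> ?p h / ?b h \<le> ?p x0 / ?b x0"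
    using continuous_attains_sup [of "sphere (0::complex^'n) 1" "\<lambda>h. ?p h / ?b h"] B sph
    by (force intro!: continuous_on_divide cont simp: less_imp_neq)
  define l where "l = ?p x0 / ?b x0"
  have bx0: "?b x0 > 0" using B sph x0 by blast
  have le: "?p h \<le> l * ?b h" for h
  proof (cases "h = 0")
    case False
    define u where "u = (1 / norm h) *\<^sub>R h"
    have u: "u \<in> sphere 0 1" using False by (simp add: u_def)
    have h: "h = norm h *\<^sub>R u" using False by (simp add: u_def)
    have "?b u > 0" using B u sph by blast
    hence "?p u \<le> l * ?b u" using max [OF u] by (simp add: l_def divide_le_eq)
    hence "(norm h)\<^sup>2 * ?p u \<le> l * ((norm h)\<^sup>2 * ?b u)"
      using mult_left_mono [of "?p u" "l * ?b u" "(norm h)\<^sup>2"] by (simp add: mult_ac)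
    thus ?thesis by (subst (1 2 3 4) h) (simp only: hom)
  qed simp
  have l0: "l > 0"
  proof (rule ccontr)
    assume "\<not> l > 0"
    have "?p h = 0" for h
    proof (cases "h = 0")
      case False
      hence "l * ?b h \<le> 0" using \<open>\<not> l > 0\<close> B [OF False] by (simp add: mult_nonpos_nonneg)
      thus ?thesis using le [of h] P by (auto simp: psd_def intro: antisym)
    qed simp
    hence "P = 0" using P by (intro hermitian_form_eq_zero) (auto simp: psd_def complex_eq_iff)
    thus False using \<open>P \<noteq> 0\<close> by simp
  qed
  define B' where "B' = (\<chi> i j. complex_of_real l * B$i$j)"
  have B': "B' *v h = complex_of_real l *s (B *v h)" for h
    by (simp add: B'_def vec_eq_iff matrix_vector_mult_def sum_distrib_left mult.assoc)
  have "psd (B' - P)"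
    using le P Bim by (simp add: psd_def matrix_vector_mult_diff_rdistrib cinner_simps B')
  moreover have "cinner ((B' - P) *v x0) x0 = 0"
    using P Bim bx0 by (simp add: psd_def matrix_vector_mult_diff_rdistrib cinner_simps B' complex_eq_iff l_def)
  ultimately have "(B' - P) *v x0 = 0" by (rule psd_null)
  hence Px0: "P *v x0 = complex_of_real l *s (B *v x0)" by (simp add: matrix_vector_mult_diff_rdistrib B')
  define q :: "complex poly" where "q = det (\<chi> i j. [: B$i$j, P$i$j :])"
  have q: "poly q z = det (\<chi> i j. B$i$j + z * P$i$j)" for z
    unfolding q_def det_def by (simp add: poly_sum poly_prod of_int_poly)
  have mv: "(\<chi> i j. B$i$j + z * P$i$j) *v h = B *v h + z *s (P *v h)" for z h
    by (simp add: vec_eq_iff matrix_vector_mult_def sum_distrib_left sum.distrib distrib_right mult.assoc)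
  have q0: "poly q 0 = det B" and q1: "poly q 1 = det (B + P)"
    unfolding q by (auto simp: vec_lambda_eta plus_vec_def)
  have root: "\<exists>r>0. z = complex_of_real (- r)" if z: "poly q z = 0" for z
  proof -
    obtain x where x: "x \<noteq> 0" "(\<chi> i j. B$i$j + z * P$i$j) *v x = 0"
      using z kernel_if_det_eq_0 unfolding q by blast
    have "cinner (B *v x + z *s (P *v x)) x = 0" using x(2) mv by simp
    hence e: "complex_of_real (?b x) + z * complex_of_real (?p x) = 0"
      using Bim P by (simp add: cinner_simps psd_def complex_eq_iff)
    have b: "?b x > 0" using B x by blast
    have p: "?p x > 0" using e b P by (cases "?p x = 0") (auto simp: psd_def less_le)
    have "z = complex_of_real (- (?b x / ?p x))"
      using e p by (simp add: field_simps add_eq_0_iff2)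
    thus ?thesis using b p by (intro exI [of _ "?b x / ?p x"]) auto
  qed
  have "poly q (- 1 / complex_of_real l) = 0"
    unfolding q
  proof (rule det_eq_0_if_kernel)
    show "(\<chi> i j. B$i$j + (- 1 / complex_of_real l) * P$i$j) *v x0 = 0"
      unfolding mv Px0 using l0 by (simp add: vec_eq_iff)
    show "x0 \<noteq> 0" using sph x0 by blast
  qed
  moreover have "poly q 0 \<noteq> 0" using root by force
  ultimately have deg: "degree q > 0" by (metis bot_nat_0.not_eq_extremum degree_eq_zeroE poly_const_conv)
  obtain rt where rt: "smult (lead_coeff q) (\<Prod>i<degree q. [:-rt i, 1:]) = q"
    by (rule complex_poly_decompose')
  have pq: "poly q z = lead_coeff q * (\<Prod>i<degree q. z - rt i)" for z
    by (subst rt [symmetric]) (simp add: poly_prod)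
  have "poly q (rt i) = 0" if "i < degree q" for i
    unfolding pq using that by (auto simp: prod_zero_iff)
  hence "\<forall>i. \<exists>r. i < degree q \<longrightarrow> r > 0 \<and> rt i = complex_of_real (- r)"
    using root by blast
  then obtain r where r: "\<And>i. i < degree q \<Longrightarrow> r i > 0 \<and> rt i = complex_of_real (- r i)"
    by metis
  define c where "c = (\<Prod>i<degree q. (1 + r i) / r i)"
  have "c > 1"
  proof -
    have "(\<Prod>i<degree q. 1) < c"
      unfolding c_def using deg r by (intro prod_mono_strict) (auto simp: field_simps add_pos_pos)
    thus ?thesis by simp
  qed
  moreover have "poly q 1 = complex_of_real c * poly q 0"
  proof -
    have "complex_of_real c * poly q 0 = lead_coeff q * (\<Prod>i<degree q. complex_of_real ((1 + r i) / r i) * (0 - rt i))"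
      unfolding pq c_def prod.distrib of_real_prod by (simp only: mult_ac)
    also have "(\<Prod>i<degree q. complex_of_real ((1 + r i) / r i) * (0 - rt i)) = (\<Prod>i<degree q. 1 - rt i)"
      using r by (intro prod.cong) (force simp: field_simps)+
    finally show ?thesis by (simp only: pq)
  qed
  ultimately show ?thesis using q0 q1 by auto
qed

lemma ex_cholesky:
  fixes D :: "complex^'n^'n"
  assumes "finite J" "psd D" "\<And>i j. D$i$j \<noteq> 0 \<Longrightarrow> i \<in> J \<and> j \<in> J"
  shows "\<exists>R. cadj R ** R = D \<and> (\<forall>i j. i \<notin> J \<longrightarrow> R$i$j = 0)"
  using assms
proof (induction J arbitrary: D rule: finite_induct)
  case empty
  hence "D = 0" by (auto simp: vec_eq_iff)
  thus ?case by (intro exI [of _ 0]) (auto simp: cadj_def transpose_def matrix_matrix_mult_def vec_eq_iff)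
next
  case (insert a J)
  note psd = \<open>psd D\<close>
  have col: "D *v axis a 1 = column a D" by (simp add: matrix_vector_mult_axis)
  have herm: "D$i$j = cnj (D$j$i)" for i j
    using psd_hermitian [OF psd, of "axis j 1" "axis i 1"]
    by (simp add: cinner_axis_right matrix_vector_mult_axis column_def)
  define d where "d = Re (D$a$a)"
  have Daa: "D$a$a = complex_of_real d" and d0: "d \<ge> 0"
    using psd [unfolded psd_def, rule_format, of "axis a 1"]
    by (auto simp: cinner_axis_right col column_def d_def complex_eq_iff)
  show ?case
  proof (cases "d = 0")
    case True
    have "D *v axis a 1 = 0"
      by (rule psd_null [OF psd]) (simp add: cinner_axis_right col column_def Daa True)
    hence ca: "D$i$a = 0" for i by (simp add: col column_def vec_eq_iff)
    hence ra: "D$a$i = 0" for i using herm [of a i] by simp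
    have "\<exists>R. cadj R ** R = D \<and> (\<forall>i j. i \<notin> J \<longrightarrow> R$i$j = 0)"
    proof (rule insert.IH [OF psd])
      fix i j assume "D$i$j \<noteq> 0"
      thus "i \<in> J \<and> j \<in> J" using insert.prems(2) [of i j] ca ra by auto
    qed
    thus ?thesis by blast
  next
    case False
    hence d: "d > 0" using d0 by simp
    define D' where "D' = (\<chi> i j. D$i$j - D$i$a * D$a$j / complex_of_real d)"
    have form: "cinner (D' *v h) h = cinner (D *v (h - t *s axis a 1)) (h - t *s axis a 1)"
      if t: "t = (D *v h)$a / complex_of_real d" for h t
    proof -
      have Dh: "D' *v h = D *v h - t *s column a D"
        by (simp add: vec_eq_iff D'_def t matrix_vector_mult_def column_def
            right_diff_distrib sum_subtractf sum_distrib_left sum_divide_distrib mult_ac)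
      have "cinner (D *v axis a 1) h = cnj ((D *v h)$a)"
        using psd_hermitian [OF psd, of "axis a 1" h] by (simp add: cinner_axis_right)
      thus ?thesis using d
        unfolding Dh by (simp add: matrix_vector_mult_diff_distrib vector_scalar_commute cinner_simps
           cinner_axis_right col t) (simp add: column_def Daa)
    qed
    have "psd D'" using psd form unfolding psd_def by metis
    moreover have "i \<in> J \<and> j \<in> J" if "D'$i$j \<noteq> 0" for i j
    proof -
      have "i \<noteq> a" "j \<noteq> a" using that d by (auto simp: D'_def Daa)
      moreover have "D$i$j \<noteq> 0 \<or> (D$i$a \<noteq> 0 \<and> D$a$j \<noteq> 0)" using that by (auto simp: D'_def)
      ultimately show ?thesis using insert.prems(2) by blast
    qed
    ultimately obtain R' where R': "cadj R' ** R' = D'" "\<And>i j. i \<notin> J \<Longrightarrow> R'$i$j = 0"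
      using insert.IH by blast
    define R where "R = (\<chi> i j. if i = a then D$a$j / complex_of_real (sqrt d) else R'$i$j)"
    have sq: "complex_of_real (sqrt d) * complex_of_real (sqrt d) = complex_of_real d"
      using d by (simp flip: of_real_mult)
    have "cadj R ** R = D"
    proof -
      have "(cadj R ** R)$i$j = D$i$j" for i j
      proof -
        have "(cadj R ** R)$i$j = (\<Sum>k\<in>UNIV. cnj (R$k$i) * R$k$j)"
          by (simp add: cadj_def transpose_def matrix_matrix_mult_def)
        also have "\<dots> = (\<Sum>k\<in>UNIV. cnj (R'$k$i) * R'$k$j + (if k = a then cnj (D$a$i) * D$a$j / complex_of_real d else 0))"
          using R'(2) [of a] insert.hyps(2) sq
          by (intro sum.cong) (auto simp: R_def)
        also have "\<dots> = (cadj R' ** R')$i$j + cnj (D$a$i) * D$a$j / complex_of_real d"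
          by (simp add: sum.distrib cadj_def transpose_def matrix_matrix_mult_def)
        also have "\<dots> = D$i$j" using herm [of i a] by (simp add: R'(1) D'_def)
        finally show ?thesis .
      qed
      thus ?thesis by (simp add: vec_eq_iff)
    qed
    moreover have "\<forall>i j. i \<notin> insert a J \<longrightarrow> R$i$j = 0" using R'(2) by (auto simp: R_def)
    ultimately show ?thesis by blast
  qed
qed

section \<open>Operators on the Fock space\<close>

type_synonym 'm fock = "(nat list, complex^'m) ell2"

lemma norm_cscale: "norm (c *s x) = cmod c * norm (x :: complex^'n)"
  by (simp add: norm_vec_def norm_mult L2_set_right_distrib)

lemma norm_matrix_sq: "(norm (A :: complex^'n^'m))\<^sup>2 = (\<Sum>j\<in>UNIV. (norm (column j A))\<^sup>2)"
proof -
  have "(norm A)\<^sup>2 = (\<Sum>i\<in>UNIV. \<Sum>j\<in>UNIV. (cmod (A$i$j))\<^sup>2)"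
    by (simp add: norm_vec_def L2_set_def sum_nonneg)
  also have "\<dots> = (\<Sum>j\<in>UNIV. \<Sum>i\<in>UNIV. (cmod (A$i$j))\<^sup>2)" by (rule sum.swap)
  also have "\<dots> = (\<Sum>j\<in>UNIV. (norm (column j A))\<^sup>2)"
    by (simp add: norm_vec_def L2_set_def sum_nonneg column_def)
  finally show ?thesis .
qed

lemma norm_column_le: "norm (column j (A :: complex^'n^'m)) \<le> norm A"
proof -
  have "(norm (column j A))\<^sup>2 \<le> (\<Sum>j\<in>UNIV. (norm (column j A))\<^sup>2)" by (rule member_le_sum) auto
  thus ?thesis by (simp flip: norm_matrix_sq)
qed

lemma matrix_vector_mult_columns:
  "(A :: complex^'n^'m) *v h = (\<Sum>j\<in>UNIV. h$j *s column j A)"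
  by (simp add: vec_eq_iff matrix_vector_mult_def column_def mult.commute)

lemma norm_shiftS_sq_summable:
  fixes u :: "nat list \<Rightarrow> 'b::real_inner"
  assumes "(\<lambda>x. (norm (u x))\<^sup>2) summable_on UNIV"
  shows "(\<lambda>x. (norm (shiftS \<omega> u x))\<^sup>2) summable_on UNIV"
proof -
  have "((\<lambda>x. (norm (shiftS \<omega> u x))\<^sup>2) \<circ> (@) \<omega>) summable_on UNIV"
    using assms by (simp add: o_def shiftS_def)
  hence "(\<lambda>x. (norm (shiftS \<omega> u x))\<^sup>2) summable_on range ((@) \<omega>)"
    by (subst summable_on_reindex) (auto simp: inj_on_def)
  thus ?thesis
    by (rule summable_on_cong_neutral [THEN iffD1, rotated -1])
       (auto simp: shiftS_def, metis append_take_drop_id rangeI)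
qed

lift_definition shift :: "nat list \<Rightarrow> (nat list, 'b::real_inner) ell2 \<Rightarrow> (nat list, 'b) ell2" is shiftS
  by (rule norm_shiftS_sq_summable)

declare shift.rep_eq [simp]

lift_definition cscale :: "complex \<Rightarrow> 'm::finite fock \<Rightarrow> 'm fock" is "\<lambda>c u x. c *s u x"
  by (simp add: norm_cscale power_mult_distrib summable_on_cmult_right)

declare cscale.rep_eq [simp]

lemma shift_add: "shift \<omega> (u + v) = shift \<omega> u + shift \<omega> v"
  by (intro ell2_eqI) (simp add: shiftS_def)
lemma shift_diff: "shift \<omega> (u - v) = shift \<omega> u - shift \<omega> v"
  by (intro ell2_eqI) (simp add: shiftS_def)
lemma shift_zero [simp]: "shift \<omega> 0 = 0"
  by (intro ell2_eqI) (simp add: shiftS_def)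
lemma shift_sum: "shift \<omega> (\<Sum>i\<in>I. f i) = (\<Sum>i\<in>I. shift \<omega> (f i))"
  by (induction I rule: infinite_finite_induct) (auto simp: shift_add)
lemma shift_cscale: "shift \<omega> (cscale c u) = cscale c (shift \<omega> u)"
  by (intro ell2_eqI) (simp add: shiftS_def)
lemma shift_Nil [simp]: "shift [] u = u"
  by (intro ell2_eqI) (simp add: shiftS_def)
lemma shift_shift: "shift \<alpha> (shift \<beta> u) = shift (\<alpha> @ \<beta>) u"
proof (rule ell2_eqI)
  fix x :: "nat list"
  have "take (length (\<alpha> @ \<beta>)) x = \<alpha> @ \<beta> \<longleftrightarrow>
      take (length \<alpha>) x = \<alpha> \<and> take (length \<beta>) (drop (length \<alpha>) x) = \<beta>"
    by (auto simp: take_add) (metis append_eq_conv_conj append_take_drop_id take_add take_take)+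
  thus "coord (shift \<alpha> (shift \<beta> u)) x = coord (shift (\<alpha> @ \<beta>) u) x"
    by (simp add: shiftS_def add.commute)
qed

lemma norm_shift [simp]: "norm (shift \<omega> u) = norm u"
proof -
  have "(norm (shift \<omega> u))\<^sup>2 = infsum (\<lambda>x. (norm (shiftS \<omega> (coord u) x))\<^sup>2) (range ((@) \<omega>))"
    unfolding ell2_norm_sq shift.rep_eq
    by (rule infsum_cong_neutral) (auto simp: shiftS_def, metis append_take_drop_id rangeI)
  also have "\<dots> = (norm u)\<^sup>2"
    unfolding ell2_norm_sq by (subst infsum_reindex) (auto simp: inj_on_def o_def shiftS_def)
  finally show ?thesis by simp
qed

lemma cscale_add: "cscale c (u + v) = cscale c u + cscale c v"
  by (intro ell2_eqI) (simp add: vec.scale_right_distrib)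
lemma cscale_diff: "cscale c (u - v) = cscale c u - cscale c v"
  by (intro ell2_eqI) (simp add: vec.scale_right_diff_distrib)
lemma cscale_zero [simp]: "cscale c 0 = 0" "cscale 0 u = 0"
  by (auto intro!: ell2_eqI)
lemma cscale_sum: "cscale c (\<Sum>i\<in>I. f i) = (\<Sum>i\<in>I. cscale c (f i))"
  by (induction I rule: infinite_finite_induct) (auto simp: cscale_add)
lemma cscale_add_left: "cscale (c + d) u = cscale c u + cscale d u"
  by (intro ell2_eqI) (simp add: vec.scale_left_distrib)
lemma cscale_cscale: "cscale c (cscale d u) = cscale (c * d) u"
  by (intro ell2_eqI) simp
lemma cscale_1 [simp]: "cscale 1 u = u"
  by (intro ell2_eqI) simp
lemma scaleR_eq_cscale: "r *\<^sub>R u = cscale (complex_of_real r) u"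
  by (intro ell2_eqI) (simp add: scaleR_eq_scale)

lemma norm_cscale_ell2: "norm (cscale c u) = cmod c * norm u"
proof -
  have "(norm (cscale c u))\<^sup>2 = (cmod c * norm u)\<^sup>2"
    by (simp add: power_mult_distrib ell2_norm_sq norm_cscale infsum_cmult_right coord_sq_summable)
  thus ?thesis by (simp add: power2_eq_iff_nonneg)
qed

definition cin :: "'m::finite fock \<Rightarrow> 'm fock \<Rightarrow> complex" where
  "cin u v = l2inner (coord u) (coord v)"

lemma cin_has_sum:
  fixes u v :: "'m::finite fock"
  shows "((\<lambda>x. cinner (coord u x) (coord v x)) has_sum Complex (inner u v) (inner u (cscale \<i> v))) UNIV"
proof -
  have hs: "((\<lambda>x. inner (coord u x) (coord v x)) has_sum inner u v) UNIV" for u v :: "'m::finite fock"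
    unfolding inner_ell2_def by (intro has_sum_infsum sq_summable_inner coord_sq_summable)
  have "((\<lambda>x. complex_of_real (inner (coord u x) (coord v x)) + \<i> * complex_of_real (inner (coord u x) (coord (cscale \<i> v) x)))
      has_sum complex_of_real (inner u v) + \<i> * complex_of_real (inner u (cscale \<i> v))) UNIV"
    by (intro has_sum_add has_sum_cmult_right has_sum_of_real hs)
  moreover have "complex_of_real (inner x y) + \<i> * complex_of_real (inner x (\<i> *s y)) = cinner x y" for x y :: "complex^'m"
    by (simp add: complex_eq_iff cinner_scale_right flip: Re_cinner)
  ultimately show ?thesis by (simp add: Complex_eq)
qed

lemma cin_eq: "cin u v = Complex (inner u v) (inner u (cscale \<i> v))"
  unfolding cin_def l2inner_def using cin_has_sum by (rule infsumI)
lemma Re_cin [simp]: "Re (cin u v) = inner u v"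
  by (simp add: cin_eq)
lemma cin_add_left: "cin (u + v) w = cin u w + cin v w"
  by (simp add: cin_eq inner_add_left complex_eq_iff)
lemma cin_add_right: "cin u (v + w) = cin u v + cin u w"
  by (simp add: cin_eq inner_add_right cscale_add complex_eq_iff)
lemma cin_zero [simp]: "cin 0 u = 0" "cin u 0 = 0"
  by (auto simp: cin_eq complex_eq_iff)
lemma cin_scale_left: "cin (cscale c u) v = c * cin u v"
  by (simp add: cin_def l2inner_def cinner_scale_left infsum_cmult_right')
lemma cin_scale_right: "cin u (cscale c v) = cnj c * cin u v"
  by (simp add: cin_def l2inner_def cinner_scale_right infsum_cmult_right')
lemma cin_sum_left: "cin (\<Sum>i\<in>I. f i) v = (\<Sum>i\<in>I. cin (f i) v)"
  by (induction I rule: infinite_finite_induct) (auto simp: cin_add_left)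
lemma cin_sum_right: "cin v (\<Sum>i\<in>I. f i) = (\<Sum>i\<in>I. cin v (f i))"
  by (induction I rule: infinite_finite_induct) (auto simp: cin_add_right)
lemma inner_cscale_left: "inner (cscale c u) v = inner u (cscale (cnj c) v)"
  by (simp flip: Re_cin add: cin_scale_left cin_scale_right)

lemma cin_self: "cin u u = complex_of_real ((norm u)\<^sup>2)"
proof -
  have "inner u (cscale \<i> u) = - inner u (cscale \<i> u)"
    using inner_cscale_left [of \<i> u u] inner_commute [of u "cscale \<i> u"]
      inner_minus_right [of u "cscale \<i> u"]
    by (simp flip: Re_cin add: cin_scale_left cin_scale_right)
  thus ?thesis by (simp add: cin_eq complex_eq_iff power2_norm_eq_inner)
qed

definition in_fock :: "nat \<Rightarrow> 'm::finite fock \<Rightarrow> bool" where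
  "in_fock n u \<longleftrightarrow> (\<forall>\<alpha>. \<alpha> \<notin> Wds n \<longrightarrow> coord u \<alpha> = 0)"

lemma in_FE_iff: "in_FE n v \<longleftrightarrow> (\<exists>u. in_fock n u \<and> v = coord u)"
  unfolding in_FE_def in_fock_def by (metis coord_Abs coord_sq_summable)

lemma l2norm_coord: "l2norm (coord u) = norm u"
  by (simp add: l2norm_def flip: ell2_norm_sq)

lemma Wds_append [simp]: "\<alpha> @ \<beta> \<in> Wds n \<longleftrightarrow> \<alpha> \<in> Wds n \<and> \<beta> \<in> Wds n"
  by (auto simp: Wds_def)
lemma Wds_Nil [simp]: "[] \<in> Wds n"
  by (auto simp: Wds_def)

lemma in_fock_shift: "\<omega> \<in> Wds n \<Longrightarrow> in_fock n u \<Longrightarrow> in_fock n (shift \<omega> u)"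
  unfolding in_fock_def by (auto simp: shiftS_def) (metis Wds_append append_take_drop_id)

definition opcol :: "(nat list \<Rightarrow> complex^'m^'m) \<Rightarrow> 'm \<Rightarrow> 'm::finite fock" where
  "opcol T j = Abs_ell2 (\<lambda>\<alpha>. column j (T \<alpha>))"

definition op_app :: "(nat list \<Rightarrow> complex^'m^'m) \<Rightarrow> complex^'m \<Rightarrow> 'm::finite fock" where
  "op_app T h = (\<Sum>j\<in>UNIV. cscale (h$j) (opcol T j))"

lemma coord_opcol:
  assumes "is_op n T" shows "coord (opcol T j) \<alpha> = column j (T \<alpha>)"
proof -
  have "(\<lambda>\<alpha>. (norm (column j (T \<alpha>)))\<^sup>2) summable_on UNIV"
    using assms unfolding is_op_def
    by (elim conjE summable_on_comparison_test) (auto intro: power_mono norm_column_le)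
  thus ?thesis by (simp add: opcol_def coord_Abs)
qed

lemma coord_op_app: "is_op n T \<Longrightarrow> coord (op_app T h) \<alpha> = T \<alpha> *v h"
  by (simp add: op_app_def coord_opcol matrix_vector_mult_columns)

lemma coord_op_app': "is_op n T \<Longrightarrow> coord (op_app T h) = theta_app T h"
  by (simp add: fun_eq_iff coord_op_app theta_app_def)

lemma in_fock_op_app: "is_op n T \<Longrightarrow> in_fock n (op_app T h)"
  unfolding in_fock_def by (simp add: coord_op_app) (simp add: is_op_def)

lemma op_app_add: "op_app T (g + h) = op_app T g + op_app T h"
  by (simp add: op_app_def cscale_add_left sum.distrib)
lemma op_app_zero [simp]: "op_app T 0 = 0"
  by (simp add: op_app_def)
lemma op_app_scale: "op_app T (c *s h) = cscale c (op_app T h)"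
  by (simp add: op_app_def cscale_sum cscale_cscale)
lemma op_app_axis: "op_app T (axis j 1) = opcol T j"
proof -
  have "op_app T (axis j 1) = (\<Sum>i\<in>UNIV. if i = j then opcol T i else 0)"
    unfolding op_app_def by (intro sum.cong) (auto simp: axis_def)
  thus ?thesis by simp
qed

definition op_of_cols :: "('m \<Rightarrow> 'm::finite fock) \<Rightarrow> nat list \<Rightarrow> complex^'m^'m" where
  "op_of_cols l \<alpha> = (\<chi> i j. coord (l j) \<alpha> $ i)"

lemma column_op_of_cols: "column j (op_of_cols l \<alpha>) = coord (l j) \<alpha>"
  by (simp add: op_of_cols_def column_def vec_eq_iff)

lemma is_op_op_of_cols:
  assumes "\<And>j. in_fock n (l j)" shows "is_op n (op_of_cols l)"
  unfolding is_op_def norm_matrix_sq column_op_of_cols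
proof (intro conjI allI impI)
  have "(\<lambda>\<alpha>. \<Sum>j\<in>J. (norm (coord (l j) \<alpha>))\<^sup>2) summable_on UNIV" for J
    by (induction J rule: infinite_finite_induct) (auto intro!: summable_on_add coord_sq_summable)
  thus "(\<lambda>\<alpha>. \<Sum>j\<in>UNIV. (norm (coord (l j) \<alpha>))\<^sup>2) summable_on UNIV" .
  fix \<alpha> assume "\<alpha> \<notin> Wds n"
  thus "op_of_cols l \<alpha> = 0" using assms by (simp add: in_fock_def op_of_cols_def vec_eq_iff)
qed

lemma opcol_op_of_cols: "opcol (op_of_cols l) j = l j"
  by (simp add: opcol_def column_op_of_cols coord_inverse)

lemma op_app_op_of_cols: "op_app (op_of_cols l) h = (\<Sum>j\<in>UNIV. cscale (h$j) (l j))"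
  by (simp add: op_app_def opcol_op_of_cols)

lemma kernel_entry:
  "is_op n T \<Longrightarrow> kernel T \<sigma> \<omega> $ i $ j = cin (shift \<omega> (opcol T j)) (shift \<sigma> (opcol T i))"
  by (simp add: kernel_def cin_def coord_op_app' [symmetric] op_app_axis)

lemma cinner_kernel:
  assumes "is_op n T"
  shows "cinner (kernel T \<sigma> \<omega> *v h) h' = cin (shift \<omega> (op_app T h)) (shift \<sigma> (op_app T h'))"
proof -
  have "cinner (kernel T \<sigma> \<omega> *v h) h' = (\<Sum>i\<in>UNIV. \<Sum>j\<in>UNIV. h$j * cnj (h'$i) * kernel T \<sigma> \<omega> $ i $ j)"
    by (simp add: cinner_def matrix_vector_mult_def sum_distrib_right)
       (simp add: mult_ac)
  also have "\<dots> = cin (shift \<omega> (op_app T h)) (shift \<sigma> (op_app T h'))"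
    by (simp add: kernel_entry [OF assms] op_app_def shift_sum shift_cscale cin_sum_left cin_sum_right cin_scale_left cin_scale_right
        sum_distrib_left mult_ac)
  finally show ?thesis .
qed

definition mop :: "(nat list \<Rightarrow> complex^'m^'m) \<Rightarrow> (nat list \<Rightarrow> complex^'m) \<Rightarrow> 'm::finite fock" where
  "mop T p = (\<Sum>\<alpha> | p \<alpha> \<noteq> 0. shift \<alpha> (op_app T (p \<alpha>)))"

lemma coord_mop: "is_op n T \<Longrightarrow> coord (mop T p) = Mpoly T p"
  by (simp add: fun_eq_iff mop_def Mpoly_def coord_op_app')

lemma mop_superset:
  assumes "finite F" "\<And>\<alpha>. p \<alpha> \<noteq> 0 \<Longrightarrow> \<alpha> \<in> F"
  shows "mop T p = (\<Sum>\<alpha>\<in>F. shift \<alpha> (op_app T (p \<alpha>)))"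
  unfolding mop_def using assms by (intro sum.mono_neutral_left) auto

abbreviation fin_supp :: "(nat list \<Rightarrow> complex^'m) \<Rightarrow> bool" where
  "fin_supp p \<equiv> finite {\<alpha>. p \<alpha> \<noteq> 0}"

lemma mop_add:
  assumes "fin_supp p" "fin_supp q"
  shows "mop T (\<lambda>\<alpha>. p \<alpha> + q \<alpha>) = mop T p + mop T q"
proof -
  define F where "F = {\<alpha>. p \<alpha> \<noteq> 0} \<union> {\<alpha>. q \<alpha> \<noteq> 0}"
  have "finite F" using assms by (simp add: F_def)
  thus ?thesis
    by (subst (1 2 3) mop_superset [of F]) (auto simp: F_def op_app_add shift_add sum.distrib)
qed

lemma mop_scale:
  assumes "fin_supp p" shows "mop T (\<lambda>\<alpha>. c *s p \<alpha>) = cscale c (mop T p)"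
proof -
  define F where "F = {\<alpha>. p \<alpha> \<noteq> 0}"
  have "finite F" using assms by (simp add: F_def)
  thus ?thesis
    by (subst (1 2) mop_superset [of F]) (auto simp: F_def op_app_scale shift_cscale cscale_sum)
qed

definition pt :: "nat list \<Rightarrow> complex^'m \<Rightarrow> nat list \<Rightarrow> complex^'m" where
  "pt \<omega> h \<alpha> = (if \<alpha> = \<omega> then h else 0)"

lemma fin_supp_pt [simp]: "fin_supp (pt \<omega> h)"
  by (rule finite_subset [of _ "{\<omega>}"]) (auto simp: pt_def split: if_splits)

lemma mop_pt: "mop T (pt \<omega> h) = shift \<omega> (op_app T h)"
  by (subst mop_superset [of "{\<omega>}"]) (auto simp: pt_def split: if_splits)

lemma shiftS_append [simp]: "shiftS \<omega> p (\<omega> @ \<alpha>) = p \<alpha>"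
  by (simp add: shiftS_def)

lemma shiftS_supp: "{\<alpha>. shiftS \<omega> p \<alpha> \<noteq> 0} = (@) \<omega> ` {\<alpha>. p \<alpha> \<noteq> 0}"
  by (auto simp: shiftS_def image_iff) (metis append_take_drop_id)

lemma mop_shiftS: "mop T (shiftS \<omega> p) = shift \<omega> (mop T p)"
  unfolding mop_def shiftS_supp
  by (subst sum.reindex) (auto simp: inj_on_def shift_sum shift_shift)

lemma is_poly_add: "is_poly n p \<Longrightarrow> is_poly n q \<Longrightarrow> is_poly n (\<lambda>\<alpha>. p \<alpha> + q \<alpha>)"
  unfolding is_poly_def
  by (auto intro: finite_subset [of _ "{\<alpha>. p \<alpha> \<noteq> 0} \<union> {\<alpha>. q \<alpha> \<noteq> 0}"])
     (metis (mono_tags) add.right_neutral mem_Collect_eq subsetD)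
lemma is_poly_scale: "is_poly n p \<Longrightarrow> is_poly n (\<lambda>\<alpha>. c *s p \<alpha>)"
  unfolding is_poly_def by (auto intro: finite_subset [of _ "{\<alpha>. p \<alpha> \<noteq> 0}"])
lemma is_poly_pt: "\<omega> \<in> Wds n \<Longrightarrow> is_poly n (pt \<omega> h)"
  unfolding is_poly_def pt_def by (auto split: if_splits)
lemma is_poly_shiftS: "\<omega> \<in> Wds n \<Longrightarrow> is_poly n p \<Longrightarrow> is_poly n (shiftS \<omega> p)"
  unfolding is_poly_def shiftS_supp by auto
lemma is_poly_diff: "is_poly n p \<Longrightarrow> is_poly n q \<Longrightarrow> is_poly n (\<lambda>\<alpha>. p \<alpha> - q \<alpha>)"
  using is_poly_add [of n p "\<lambda>\<alpha>. (-1) *s q \<alpha>"] is_poly_scale [of n q "-1"] by simp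
lemma mop_diff:
  assumes "fin_supp p" "fin_supp q"
  shows "mop T (\<lambda>\<alpha>. p \<alpha> - q \<alpha>) = mop T p - mop T q"
proof -
  have "fin_supp (\<lambda>\<alpha>. p \<alpha> - q \<alpha>)"
    by (rule finite_subset [of _ "{\<alpha>. p \<alpha> \<noteq> 0} \<union> {\<alpha>. q \<alpha> \<noteq> 0}"]) (use assms in auto)
  from mop_add [OF this assms(2), of T] show ?thesis by simp
qed
lemma is_poly_zero: "is_poly n (\<lambda>_. 0)"
  by (simp add: is_poly_def)
lemma mop_zero [simp]: "mop T (\<lambda>_. 0) = 0"
  by (simp add: mop_def)

lemma is_poly_fin_supp: "is_poly n p \<Longrightarrow> fin_supp p"
  by (simp add: is_poly_def)

lemma in_fock_sum: "(\<And>i. i \<in> I \<Longrightarrow> in_fock n (f i)) \<Longrightarrow> in_fock n (\<Sum>i\<in>I. f i)"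
  by (simp add: in_fock_def)
lemma in_fock_diff: "in_fock n u \<Longrightarrow> in_fock n v \<Longrightarrow> in_fock n (u - v)"
  by (simp add: in_fock_def)

lemma in_fock_mop: "is_op n T \<Longrightarrow> is_poly n p \<Longrightarrow> in_fock n (mop T p)"
  unfolding mop_def is_poly_def by (intro in_fock_sum in_fock_shift in_fock_op_app) auto

lemma coord_mop_Nil: "is_op n T \<Longrightarrow> fin_supp p \<Longrightarrow> coord (mop T p) [] = T [] *v p []"
proof -
  assume T: "is_op n T" and p: "fin_supp p"
  have "coord (mop T p) [] = (\<Sum>\<alpha>\<in>insert [] {\<alpha>. p \<alpha> \<noteq> 0}. if \<alpha> = [] then T [] *v p [] else 0)"
    using p by (subst mop_superset [of "insert [] {\<alpha>. p \<alpha> \<noteq> 0}"])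
      (auto intro!: sum.cong simp: shiftS_def coord_op_app [OF T])
  thus ?thesis using p by simp
qed

section \<open>The spaces generated by the higher-order terms\<close>

lemma bounded_linear_shift: "bounded_linear (shift \<omega>)"
  by (rule bounded_linear_intro [where K = 1])
     (auto simp: shift_add intro!: ell2_eqI simp: shiftS_def)

lemma bounded_linear_cscale: "bounded_linear (cscale c)"
  by (rule bounded_linear_intro [where K = "cmod c"])
     (auto simp: cscale_add norm_cscale_ell2 scaleR_eq_cscale cscale_cscale mult.commute)

lemma subspace_closure:
  fixes S :: "'a::real_normed_vector set"
  assumes "subspace S" shows "subspace (closure S)"
proof (rule subspaceI)
  show "0 \<in> closure S" using assms closure_subset subspace_0 by blast
next
  fix x y assume "x \<in> closure S" "y \<in> closure S"
  then obtain f g where fg: "\<And>n. f n \<in> S" "f \<longlonglongrightarrow> x" "\<And>n. g n \<in> S" "g \<longlonglongrightarrow> y"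
    unfolding closure_sequential by blast
  have "(\<lambda>n. f n + g n) \<longlonglongrightarrow> x + y" by (intro tendsto_intros fg)
  thus "x + y \<in> closure S"
    unfolding closure_sequential using fg subspace_add [OF assms] by (intro exI [of _ "\<lambda>n. f n + g n"]) auto
next
  fix c x assume "x \<in> closure S"
  then obtain f where f: "\<And>n. f n \<in> S" "f \<longlonglongrightarrow> x" unfolding closure_sequential by blast
  have "(\<lambda>n. c *\<^sub>R f n) \<longlonglongrightarrow> c *\<^sub>R x" by (intro tendsto_intros f)
  thus "c *\<^sub>R x \<in> closure S"
    unfolding closure_sequential using f subspace_scale [OF assms] by (intro exI [of _ "\<lambda>n. c *\<^sub>R f n"]) auto
qed

lemma inner_closure_eq_0:
  assumes "\<And>s. s \<in> S \<Longrightarrow> inner u s = 0" "x \<in> closure S"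
  shows "inner u x = 0"
proof -
  obtain f where f: "\<And>n. f n \<in> S" "f \<longlonglongrightarrow> x" using assms(2) unfolding closure_sequential by blast
  have "(\<lambda>n. inner u (f n)) \<longlonglongrightarrow> inner u x" by (intro tendsto_intros f)
  moreover have "(\<lambda>n. inner u (f n)) = (\<lambda>_. 0)" using assms(1) f(1) by auto
  ultimately show ?thesis by (simp add: LIMSEQ_const_iff)
qed

definition gen_space :: "nat \<Rightarrow> (nat list \<Rightarrow> complex^'m^'m) \<Rightarrow> nat \<Rightarrow> 'm::finite fock set" where
  "gen_space n T k = {mop T p | p. is_poly n p \<and> (\<forall>\<alpha>. length \<alpha> < k \<longrightarrow> p \<alpha> = 0)}"

lemma mop_in_gen_space:
  "is_poly n p \<Longrightarrow> (\<And>\<alpha>. length \<alpha> < k \<Longrightarrow> p \<alpha> = 0) \<Longrightarrow> mop T p \<in> gen_space n T k"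
  unfolding gen_space_def by blast

lemma gen_space_mono: "k \<le> l \<Longrightarrow> gen_space n T l \<subseteq> gen_space n T k"
  unfolding gen_space_def by force

lemma gen_space_cscale:
  assumes "u \<in> gen_space n T k" shows "cscale c u \<in> gen_space n T k"
proof -
  obtain p where p: "is_poly n p" "\<forall>\<alpha>. length \<alpha> < k \<longrightarrow> p \<alpha> = 0" "u = mop T p"
    using assms unfolding gen_space_def by blast
  have "mop T (\<lambda>\<alpha>. c *s p \<alpha>) \<in> gen_space n T k"
    using p by (intro mop_in_gen_space is_poly_scale) auto
  thus ?thesis using p by (simp add: mop_scale is_poly_fin_supp)
qed

lemma gen_space_shift:
  assumes "u \<in> gen_space n T k" "\<omega> \<in> Wds n" shows "shift \<omega> u \<in> gen_space n T (length \<omega> + k)"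
proof -
  obtain p where p: "is_poly n p" "\<forall>\<alpha>. length \<alpha> < k \<longrightarrow> p \<alpha> = 0" "u = mop T p"
    using assms unfolding gen_space_def by blast
  have "mop T (shiftS \<omega> p) \<in> gen_space n T (length \<omega> + k)"
  proof (rule mop_in_gen_space)
    show "is_poly n (shiftS \<omega> p)" using p assms(2) by (intro is_poly_shiftS)
    fix \<alpha> :: "nat list" assume \<alpha>: "length \<alpha> < length \<omega> + k"
    show "shiftS \<omega> p \<alpha> = 0"
    proof (cases "take (length \<omega>) \<alpha> = \<omega>")
      case True
      hence "length \<omega> \<le> length \<alpha>" by (metis length_take min.cobounded1)
      hence "length (drop (length \<omega>) \<alpha>) < k" using \<alpha> by simp
      thus ?thesis using p(2) by (simp add: shiftS_def)
    qed (simp add: shiftS_def)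
  qed
  thus ?thesis using p by (simp add: mop_shiftS)
qed

lemma subspace_gen_space: "subspace (gen_space n T k)"
proof (rule subspaceI)
  show "0 \<in> gen_space n T k"
    using mop_in_gen_space [OF is_poly_zero, of k T] by simp
next
  fix u v assume "u \<in> gen_space n T k" "v \<in> gen_space n T k"
  then obtain p q where p: "is_poly n p" "\<forall>\<alpha>. length \<alpha> < k \<longrightarrow> p \<alpha> = 0" "u = mop T p"
    and q: "is_poly n q" "\<forall>\<alpha>. length \<alpha> < k \<longrightarrow> q \<alpha> = 0" "v = mop T q"
    unfolding gen_space_def by blast
  have "mop T (\<lambda>\<alpha>. p \<alpha> + q \<alpha>) \<in> gen_space n T k"
    using p q by (intro mop_in_gen_space is_poly_add) auto
  thus "u + v \<in> gen_space n T k" using p q by (simp add: mop_add is_poly_fin_supp)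
qed (simp add: scaleR_eq_cscale gen_space_cscale)

lemmas subspace_closure_gen_space = subspace_closure [OF subspace_gen_space]

lemma closure_gen_space_cscale:
  assumes "u \<in> closure (gen_space n T k)" shows "cscale c u \<in> closure (gen_space n T k)"
proof -
  have "cscale c u \<in> closure (cscale c ` gen_space n T k)"
    using assms closure_bounded_linear_image_subset [OF bounded_linear_cscale] by blast
  moreover have "cscale c ` gen_space n T k \<subseteq> gen_space n T k" using gen_space_cscale by blast
  ultimately show ?thesis using closure_mono by blast
qed

lemma closure_gen_space_shift:
  assumes "u \<in> closure (gen_space n T k)" "\<omega> \<in> Wds n"
  shows "shift \<omega> u \<in> closure (gen_space n T (length \<omega> + k))"
proof -
  have "shift \<omega> u \<in> closure (shift \<omega> ` gen_space n T k)"
    using assms(1) closure_bounded_linear_image_subset [OF bounded_linear_shift] by blast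
  moreover have "shift \<omega> ` gen_space n T k \<subseteq> gen_space n T (length \<omega> + k)"
    using gen_space_shift assms(2) by blast
  ultimately show ?thesis using closure_mono by blast
qed

lemma closure_gen_space_mono:
  "k \<le> l \<Longrightarrow> u \<in> closure (gen_space n T l) \<Longrightarrow> u \<in> closure (gen_space n T k)"
  using closure_mono [OF gen_space_mono] by blast

lemma coord_gen_space:
  assumes "u \<in> gen_space n T k" "length \<alpha> < k" shows "coord u \<alpha> = 0"
proof -
  obtain p where p: "is_poly n p" "\<forall>\<alpha>. length \<alpha> < k \<longrightarrow> p \<alpha> = 0" "u = mop T p"
    using assms unfolding gen_space_def by blast
  have "coord (shift \<beta> v) \<alpha> = 0" if "p \<beta> \<noteq> 0" for \<beta> and v :: "'a fock"
  proof -
    have "length \<beta> \<ge> k" using p(2) that not_less by blast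
    hence "take (length \<beta>) \<alpha> \<noteq> \<beta>" using assms(2) by (metis length_take min.bounded_iff not_less order_refl)
    thus ?thesis by (simp add: shiftS_def)
  qed
  thus ?thesis unfolding p(3) mop_def by simp
qed

lemma coord_closure_gen_space:
  assumes "u \<in> closure (gen_space n T k)" "length \<alpha> < k" shows "coord u \<alpha> = 0"
proof -
  obtain f where f: "\<And>n'. f n' \<in> gen_space n T k" "f \<longlonglongrightarrow> u"
    using assms(1) unfolding closure_sequential by blast
  have "(\<lambda>i. coord (f i) \<alpha>) = (\<lambda>_. 0)" using f(1) coord_gen_space assms(2) by blast
  with tendsto_coord [OF f(2), of \<alpha>] show ?thesis by (simp add: LIMSEQ_const_iff)
qed

lemma op_app_in_gen_space: "op_app T h \<in> gen_space n T 0"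
  using mop_in_gen_space [OF is_poly_pt [of "[]" n h], of 0 T] by (simp add: mop_pt)

lemma mop_split:
  assumes "is_poly n p"
  shows "mop T p - op_app T (p []) \<in> gen_space n T 1"
proof -
  have "mop T (\<lambda>\<alpha>. p \<alpha> - pt [] (p []) \<alpha>) \<in> gen_space n T 1"
    using assms by (intro mop_in_gen_space is_poly_diff is_poly_pt) (auto simp: pt_def)
  thus ?thesis using assms by (simp add: mop_diff is_poly_fin_supp mop_pt)
qed

lemma outer_iff_dense:
  assumes T: "is_op n T"
  shows "outer n T \<longleftrightarrow> (\<forall>u. in_fock n u \<longrightarrow> u \<in> closure (gen_space n T 0))"
proof -
  have *: "l2norm (\<lambda>\<beta>. coord u \<beta> - Mpoly T p \<beta>) = dist (mop T p) u" for u p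
    using l2norm_coord [of "u - mop T p"] by (simp add: coord_mop [OF T] dist_norm norm_minus_commute)
  have "outer n T \<longleftrightarrow> (\<forall>u. in_fock n u \<longrightarrow> (\<forall>e>0. \<exists>p. is_poly n p \<and> dist (mop T p) u < e))"
    unfolding outer_def in_FE_iff * [symmetric] by blast
  moreover have "(\<exists>y\<in>gen_space n T 0. dist y u < e) \<longleftrightarrow> (\<exists>p. is_poly n p \<and> dist (mop T p) u < e)" for u e
    unfolding gen_space_def by auto
  ultimately show ?thesis unfolding closure_approachable by simp
qed

lift_definition unshift :: "nat list \<Rightarrow> (nat list, 'b::real_inner) ell2 \<Rightarrow> (nat list, 'b) ell2"
  is "\<lambda>\<omega> u \<beta>. u (\<omega> @ \<beta>)"
proof -
  fix \<omega> and u :: "nat list \<Rightarrow> 'b"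
  assume "(\<lambda>x. (norm (u x))\<^sup>2) summable_on UNIV"
  hence "(\<lambda>x. (norm (u x))\<^sup>2) summable_on range ((@) \<omega>)" by (rule summable_on_subset_banach) auto
  thus "(\<lambda>x. (norm (u (\<omega> @ x)))\<^sup>2) summable_on UNIV"
    by (subst (asm) summable_on_reindex) (auto simp: inj_on_def o_def)
qed

declare unshift.rep_eq [simp]

lemma outer_dense_tail:
  assumes T: "is_op n T" and "outer n T" and u: "in_fock n u" "\<And>\<alpha>. length \<alpha> < k \<Longrightarrow> coord u \<alpha> = 0"
  shows "u \<in> closure (gen_space n T k)"
proof -
  define W where "W = {\<gamma>. set \<gamma> \<subseteq> {..<n} \<and> length \<gamma> = k}"
  have W: "finite W" unfolding W_def by (rule finite_lists_length_eq) simp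
  have "u = (\<Sum>\<gamma>\<in>W. shift \<gamma> (unshift \<gamma> u))"
  proof (rule ell2_eqI)
    fix x
    have "coord (\<Sum>\<gamma>\<in>W. shift \<gamma> (unshift \<gamma> u)) x = (\<Sum>\<gamma>\<in>W. if \<gamma> = take k x then coord u x else 0)"
      unfolding coord_sum
    proof (rule sum.cong [OF refl])
      fix \<gamma> assume "\<gamma> \<in> W"
      hence l: "length \<gamma> = k" by (simp add: W_def)
      show "coord (shift \<gamma> (unshift \<gamma> u)) x = (if \<gamma> = take k x then coord u x else 0)"
      proof (cases "take k x = \<gamma>")
        case True
        hence "\<gamma> @ drop k x = x" by auto
        thus ?thesis using True l by (simp add: shiftS_def)
      qed (use l in \<open>auto simp: shiftS_def\<close>)
    qed
    also have "\<dots> = (if take k x \<in> W then coord u x else 0)" using W by simp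
    also have "\<dots> = coord u x"
    proof (cases "take k x \<in> W")
      case False
      hence "x \<notin> Wds n \<or> length x < k"
        by (auto simp: W_def Wds_def dest: in_set_takeD)
      thus ?thesis using u by (auto simp: in_fock_def)
    qed simp
    finally show "coord u x = coord (\<Sum>\<gamma>\<in>W. shift \<gamma> (unshift \<gamma> u)) x" by simp
  qed
  also have "\<dots> \<in> closure (gen_space n T k)"
  proof (rule subspace_sum [OF subspace_closure_gen_space])
    fix \<gamma> assume \<gamma>: "\<gamma> \<in> W"
    hence "in_fock n (unshift \<gamma> u)" using u(1) by (simp add: in_fock_def W_def Wds_def)
    hence "unshift \<gamma> u \<in> closure (gen_space n T 0)" using assms(2) outer_iff_dense [OF T] by blast
    from closure_gen_space_shift [OF this, of \<gamma>] \<gamma>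
    show "shift \<gamma> (unshift \<gamma> u) \<in> closure (gen_space n T k)" by (simp add: W_def Wds_def)
  qed
  finally show ?thesis .
qed

section \<open>The prediction error\<close>

lemma kernel_form_eq_norm:
  assumes T: "is_op n T" and "finite F" "\<And>\<sigma>. \<sigma> \<notin> F \<Longrightarrow> p \<sigma> = 0"
  shows "Re (\<Sum>\<sigma>\<in>F. \<Sum>\<omega>\<in>F. cinner (kernel T \<omega> \<sigma> *v p \<sigma>) (p \<omega>)) = (norm (mop T p))\<^sup>2"
proof -
  have "mop T p = (\<Sum>\<alpha>\<in>F. shift \<alpha> (op_app T (p \<alpha>)))"
    using assms by (intro mop_superset) auto
  thus ?thesis
    by (simp add: cinner_kernel [OF T] power2_norm_eq_inner inner_sum_left inner_sum_right)
       (rule sum.swap)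
qed

lemma Delta_form_eq_Inf:
  assumes T: "is_op n T"
  shows "Delta_form n (kernel T) h = Inf {(norm (mop T p))\<^sup>2 | p. is_poly n p \<and> p [] = h}"
proof -
  have "{x. \<exists>F hs. finite F \<and> F \<subseteq> Wds n \<and> (\<forall>\<sigma>. \<sigma> \<notin> F \<longrightarrow> hs \<sigma> = 0)
      \<and> hs [] = h \<and> x = Re (\<Sum>\<sigma>\<in>F. \<Sum>\<omega>\<in>F. cinner (kernel T \<omega> \<sigma> *v hs \<sigma>) (hs \<omega>))}
    = {(norm (mop T p))\<^sup>2 | p. is_poly n p \<and> p [] = h}" (is "?A = ?B")
  proof (intro equalityI subsetI)
    fix x assume "x \<in> ?A"
    then obtain F hs where F: "finite F" "F \<subseteq> Wds n" "\<And>\<sigma>. \<sigma> \<notin> F \<Longrightarrow> hs \<sigma> = 0" "hs [] = h"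
      and x: "x = Re (\<Sum>\<sigma>\<in>F. \<Sum>\<omega>\<in>F. cinner (kernel T \<omega> \<sigma> *v hs \<sigma>) (hs \<omega>))" by blast
    have "is_poly n hs" unfolding is_poly_def using F by (auto intro: finite_subset [of _ F])
    thus "x \<in> ?B" using F x kernel_form_eq_norm [OF T F(1,3)] by auto
  next
    fix x assume "x \<in> ?B"
    then obtain p where p: "is_poly n p" "p [] = h" "x = (norm (mop T p))\<^sup>2" by blast
    show "x \<in> ?A"
      using p kernel_form_eq_norm [OF T is_poly_fin_supp [OF p(1)], of p] unfolding is_poly_def
      by (intro CollectI exI [of _ "{\<alpha>. p \<alpha> \<noteq> 0}"] exI [of _ p]) auto
  qed
  thus ?thesis unfolding Delta_form_def by simp
qed

text \<open>The range of \<open>L\<close> is the wandering subspace of the invariant subspace generated by \<open>T\<close>.\<close>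

definition wandering_part :: "nat \<Rightarrow> (nat list \<Rightarrow> complex^'m^'m) \<Rightarrow> (nat list \<Rightarrow> complex^'m^'m) \<Rightarrow> bool" where
  "wandering_part n T L \<longleftrightarrow> is_op n L \<and> (\<forall>h. op_app T h - op_app L h \<in> closure (gen_space n T 1) \<and>
     (\<forall>s\<in>gen_space n T 1. inner (op_app L h) s = 0))"

lemma in_fock_closure:
  assumes "\<And>s. s \<in> S \<Longrightarrow> in_fock n s" "u \<in> closure S" shows "in_fock n u"
  unfolding in_fock_def
proof (intro allI impI)
  fix \<alpha> assume \<alpha>: "\<alpha> \<notin> Wds n"
  obtain f where f: "\<And>i. f i \<in> S" "f \<longlonglongrightarrow> u" using assms(2) unfolding closure_sequential by blast
  have "(\<lambda>i. coord (f i) \<alpha>) = (\<lambda>_. 0)" using f(1) assms(1) \<alpha> by (auto simp: in_fock_def)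
  with tendsto_coord [OF f(2), of \<alpha>] show "coord u \<alpha> = 0" by (simp add: LIMSEQ_const_iff)
qed

lemma in_fock_gen_space: "is_op n T \<Longrightarrow> u \<in> gen_space n T k \<Longrightarrow> in_fock n u"
  unfolding gen_space_def by (auto intro: in_fock_mop)

lemma ex_wandering_part:
  assumes T: "is_op n T" shows "\<exists>L. wandering_part n T L"
proof -
  have "\<forall>j. \<exists>y\<in>closure (gen_space n T 1). \<forall>s\<in>gen_space n T 1. inner (opcol T j - y) s = 0"
    using ex_orthogonal_projection [OF subspace_gen_space] by blast
  then obtain y where y: "\<And>j. y j \<in> closure (gen_space n T 1)"
      "\<And>j s. s \<in> gen_space n T 1 \<Longrightarrow> inner (opcol T j - y j) s = 0"
    by metis
  define L where "L = op_of_cols (\<lambda>j. opcol T j - y j)"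
  have Lapp: "op_app L h = op_app T h - (\<Sum>j\<in>UNIV. cscale (h$j) (y j))" for h
    by (simp add: L_def op_app_op_of_cols op_app_def [of T] cscale_diff sum_subtractf)
  have "in_fock n (opcol T j)" for j using in_fock_op_app [OF T] by (metis op_app_axis)
  moreover have "in_fock n (y j)" for j using in_fock_closure [OF in_fock_gen_space [OF T] y(1)] .
  ultimately have "is_op n L" unfolding L_def by (intro is_op_op_of_cols in_fock_diff)
  moreover have "op_app T h - op_app L h \<in> closure (gen_space n T 1)" for h
  proof -
    have "(\<Sum>j\<in>UNIV. cscale (h$j) (y j)) \<in> closure (gen_space n T 1)"
      by (intro subspace_sum subspace_closure_gen_space closure_gen_space_cscale y)
    thus ?thesis by (simp add: Lapp)
  qed
  moreover have "inner (op_app L h) s = 0" if "s \<in> gen_space n T 1" for h s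
    unfolding L_def op_app_op_of_cols inner_sum_left inner_cscale_left
    using that by (intro sum.neutral ballI y(2) gen_space_cscale)
  ultimately show ?thesis unfolding wandering_part_def by blast
qed

context
  fixes n :: nat and T L :: "nat list \<Rightarrow> complex^'m::finite^'m"
  assumes T: "is_op n T" and L: "wandering_part n T L"
begin

lemma is_op_wandering: "is_op n L"
  using L by (simp add: wandering_part_def)

lemma wandering_diff: "op_app T h - op_app L h \<in> closure (gen_space n T 1)"
  using L by (simp add: wandering_part_def)

lemma wandering_orthogonal: "s \<in> closure (gen_space n T 1) \<Longrightarrow> inner (op_app L h) s = 0"
  by (rule inner_closure_eq_0 [of "gen_space n T 1"]) (use L wandering_part_def in blast)+

lemma coord_wandering_Nil: "coord (op_app L h) [] = T [] *v h"
  using coord_closure_gen_space [OF wandering_diff, of "[]" h] by (simp add: coord_op_app [OF T])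

lemma wandering_in_closure: "op_app L h \<in> closure (gen_space n T 0)"
proof -
  have "op_app T h - (op_app T h - op_app L h) \<in> closure (gen_space n T 0)"
    using op_app_in_gen_space [of T h n] closure_subset
    by (intro subspace_diff subspace_closure_gen_space closure_gen_space_mono [OF _ wandering_diff]) auto
  thus ?thesis by simp
qed

lemma Delta_form_eq_norm: "Delta_form n (kernel T) h = (norm (op_app L h))\<^sup>2"
proof -
  let ?B = "{(norm (mop T p))\<^sup>2 | p. is_poly n p \<and> p [] = h}"
  have low: "(norm (op_app L h))\<^sup>2 \<le> x" if x: "x \<in> ?B" for x
  proof -
    obtain p where p: "is_poly n p" "p [] = h" "x = (norm (mop T p))\<^sup>2" using x by blast
    define d where "d = (op_app T h - op_app L h) + (mop T p - op_app T h)"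
    have "d \<in> closure (gen_space n T 1)"
      unfolding d_def using mop_split [OF p(1), of T] p(2) closure_subset
      by (intro subspace_add subspace_closure_gen_space wandering_diff) auto
    hence "inner (op_app L h) d = 0" by (rule wandering_orthogonal)
    moreover have "mop T p = op_app L h + d" by (simp add: d_def)
    ultimately have "(norm (mop T p))\<^sup>2 = (norm (op_app L h))\<^sup>2 + (norm d)\<^sup>2"
      by (simp add: power2_norm_eq_inner inner_add_left inner_add_right inner_commute)
    thus ?thesis using p by simp
  qed
  have ne: "?B \<noteq> {}" using is_poly_pt [of "[]" n h] by (auto simp: pt_def)
  obtain g where g: "\<And>i. g i \<in> gen_space n T 1" "g \<longlonglongrightarrow> op_app T h - op_app L h"
    using wandering_diff unfolding closure_sequential by blast
  have mem: "(norm (op_app T h - g i))\<^sup>2 \<in> ?B" for i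
  proof -
    obtain q where q: "is_poly n q" "\<forall>\<alpha>. length \<alpha> < 1 \<longrightarrow> q \<alpha> = 0" "g i = mop T q"
      using g(1) [of i] unfolding gen_space_def by blast
    have "mop T (\<lambda>\<alpha>. pt [] h \<alpha> - q \<alpha>) = op_app T h - g i"
      using q by (simp add: mop_diff is_poly_fin_supp mop_pt)
    thus ?thesis using q is_poly_diff [OF is_poly_pt [of "[]" n h] q(1)]
      by (intro CollectI exI [of _ "\<lambda>\<alpha>. pt [] h \<alpha> - q \<alpha>"]) (auto simp: pt_def)
  qed
  have "(\<lambda>i. (norm (op_app T h - g i))\<^sup>2) \<longlonglongrightarrow> (norm (op_app T h - (op_app T h - op_app L h)))\<^sup>2"
    by (intro tendsto_intros g)
  hence "(\<lambda>i. (norm (op_app T h - g i))\<^sup>2) \<longlonglongrightarrow> (norm (op_app L h))\<^sup>2" by simp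
  moreover have "bdd_below ?B" using low by (rule bdd_belowI)
  hence "\<exists>N. \<forall>i\<ge>N. Inf ?B \<le> (norm (op_app T h - g i))\<^sup>2" using cInf_lower [OF mem] by blast
  ultimately have "Inf ?B \<le> (norm (op_app L h))\<^sup>2" by (rule LIMSEQ_le_const)
  moreover have "(norm (op_app L h))\<^sup>2 \<le> Inf ?B" using ne low by (rule cInf_greatest)
  ultimately show ?thesis unfolding Delta_form_eq_Inf [OF T] by simp
qed

lemma cinner_kernel_wandering:
  "cinner (kernel L [] [] *v h) h = complex_of_real ((norm (op_app L h))\<^sup>2)"
  by (simp add: cinner_kernel [OF is_op_wandering] cin_self)

lemma Delta_eq_kernel: "Delta n (kernel T) = kernel L [] []"
  unfolding Delta_def
proof (rule the_equality)
  show "\<forall>h. cinner (kernel L [] [] *v h) h = complex_of_real (Delta_form n (kernel T) h)"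
    by (simp only: cinner_kernel_wandering Delta_form_eq_norm) simp
  fix D :: "complex^'m^'m"
  assume "\<forall>h. cinner (D *v h) h = complex_of_real (Delta_form n (kernel T) h)"
  thus "D = kernel L [] []"
    by (intro hermitian_form_unique) (simp only: cinner_kernel_wandering Delta_form_eq_norm)
qed

lemma norm_le_wandering: "norm (T [] *v h) \<le> norm (op_app L h)"
  using norm_coord_le [of "op_app L h" "[]"] by (simp add: coord_wandering_Nil)

end

section \<open>Outer operators and the prediction error\<close>

definition id_op :: "nat list \<Rightarrow> complex^'m^'m" where
  "id_op \<alpha> = (if \<alpha> = [] then mat 1 else 0)"

lemma is_op_id_op: "is_op n (id_op :: nat list \<Rightarrow> complex^'m::finite^'m)"
proof -
  have "(\<lambda>\<alpha>. (norm (id_op \<alpha> :: complex^'m^'m))\<^sup>2) summable_on {[]}" by simp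
  hence "(\<lambda>\<alpha>. (norm (id_op \<alpha> :: complex^'m^'m))\<^sup>2) summable_on UNIV"
    by (rule summable_on_cong_neutral [THEN iffD1, rotated -1]) (auto simp: id_op_def)
  thus ?thesis unfolding is_op_def by (auto simp: id_op_def)
qed

abbreviation vac :: "complex^'m \<Rightarrow> 'm::finite fock" where
  "vac x \<equiv> op_app id_op x"

abbreviation emb :: "(nat list \<Rightarrow> complex^'m) \<Rightarrow> 'm::finite fock" where
  "emb p \<equiv> mop id_op p"

lemma coord_vac: "coord (vac x) \<alpha> = (if \<alpha> = [] then x else 0)"
  by (simp add: coord_op_app [OF is_op_id_op] id_op_def)

lemma coord_emb: "fin_supp p \<Longrightarrow> coord (emb p) \<alpha> = p \<alpha>"
proof -
  assume p: "fin_supp p"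
  have "coord (emb p) \<alpha> = (\<Sum>\<beta>\<in>insert \<alpha> {\<beta>. p \<beta> \<noteq> 0}. if \<beta> = \<alpha> then p \<alpha> else 0)"
  proof -
    have "coord (shift \<beta> (vac (p \<beta>))) \<alpha> = (if \<beta> = \<alpha> then p \<alpha> else 0)" for \<beta>
      by (auto simp: shiftS_def coord_vac)
    thus ?thesis using p by (subst mop_superset [of "insert \<alpha> {\<beta>. p \<beta> \<noteq> 0}"]) auto
  qed
  thus ?thesis using p by simp
qed

lemma norm_vac: "norm (vac x) = norm x"
proof -
  have "(norm (vac x))\<^sup>2 = infsum (\<lambda>\<alpha>. (norm (coord (vac x) \<alpha>))\<^sup>2) {[]}"
    unfolding ell2_norm_sq by (rule infsum_cong_neutral) (auto simp: coord_vac)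
  thus ?thesis by (simp add: coord_vac)
qed

lemma inner_vac: "inner u (vac x) = inner (coord u []) x"
proof -
  have "inner u (vac x) = infsum (\<lambda>\<alpha>. inner (coord u \<alpha>) (coord (vac x) \<alpha>)) {[]}"
    unfolding inner_ell2_def by (rule infsum_cong_neutral) (auto simp: coord_vac)
  thus ?thesis by (simp add: coord_vac)
qed

lemma norm_emb: "fin_supp p \<Longrightarrow> (norm (emb p))\<^sup>2 = (\<Sum>\<alpha> | p \<alpha> \<noteq> 0. (norm (p \<alpha>))\<^sup>2)"
proof -
  assume p: "fin_supp p"
  have "(norm (emb p))\<^sup>2 = infsum (\<lambda>\<alpha>. (norm (p \<alpha>))\<^sup>2) {\<alpha>. p \<alpha> \<noteq> 0}"
    unfolding ell2_norm_sq by (rule infsum_cong_neutral) (auto simp: coord_emb [OF p])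
  thus ?thesis using p by simp
qed

lemma emb_dense:
  assumes u: "in_fock n u" shows "u \<in> closure (gen_space n id_op 0)"
  unfolding closure_approachable
proof (intro allI impI)
  fix e :: real assume e: "e > 0"
  obtain F where F: "finite F" "dist (\<Sum>\<alpha>\<in>F. (norm (coord u \<alpha>))\<^sup>2) (infsum (\<lambda>\<alpha>. (norm (coord u \<alpha>))\<^sup>2) UNIV) \<le> e\<^sup>2 / 2"
    using infsum_finite_approximation [OF coord_sq_summable [of u], of "e\<^sup>2/2"] e by auto
  define p where "p = (\<lambda>\<alpha>. if \<alpha> \<in> F then coord u \<alpha> else 0)"
  have p: "is_poly n p" using u F(1) by (auto simp: is_poly_def p_def in_fock_def split: if_splits)
  note fs = is_poly_fin_supp [OF p]
  have "(norm (emb p))\<^sup>2 = (\<Sum>\<alpha>\<in>F. (norm (coord u \<alpha>))\<^sup>2)"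
    unfolding norm_emb [OF fs] using F(1)
    by (intro sum.mono_neutral_cong_left) (auto simp: p_def split: if_splits)
  hence le: "(norm u)\<^sup>2 - (norm (emb p))\<^sup>2 \<le> e\<^sup>2 / 2"
    using F(2) unfolding dist_real_def ell2_norm_sq [of u] by linarith
  have "inner (u - emb p) (emb p) = 0"
    by (rule ell2_orthogonal_if_disjoint) (simp add: coord_emb [OF fs], simp add: p_def)
  hence "(norm (u - emb p))\<^sup>2 = (norm u)\<^sup>2 - (norm (emb p))\<^sup>2"
    unfolding power2_norm_eq_inner by (simp add: inner_diff_left inner_diff_right inner_commute)
  also have "\<dots> < e\<^sup>2" using le zero_less_power [OF e, of 2] by linarith
  finally have "norm (u - emb p) < e" using e by (simp add: power2_less_imp_less)
  hence "dist (emb p) u < e" by (simp add: dist_norm norm_minus_commute)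
  thus "\<exists>y\<in>gen_space n id_op 0. dist y u < e"
    using mop_in_gen_space [OF p, of 0 id_op] by auto
qed

lemma invertible_iff_inj: "invertible (A :: complex^'n^'n) \<longleftrightarrow> (\<forall>x. A *v x = 0 \<longrightarrow> x = 0)"
  by (simp add: invertible_left_inverse matrix_left_invertible_ker)

lemma invertible_iff_surj: "invertible (A :: complex^'n^'n) \<longleftrightarrow> (\<forall>y. \<exists>x. A *v x = y)"
  unfolding invertible_right_inverse matrix_right_invertible_surjective surj_def by metis

lemma outer_imp_invertible:
  assumes T: "is_op n T" and "outer n T" shows "invertible (T [])"
proof -
  let ?R = "range (\<lambda>h. T [] *v h)"
  have "subspace ?R"
  proof (rule subspaceI)
    show "0 \<in> ?R" by (metis matrix_vector_mult_0_right rangeI)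
    show "x + y \<in> ?R" if "x \<in> ?R" "y \<in> ?R" for x y
      using that by (auto simp flip: matrix_vector_right_distrib)
    show "c *\<^sub>R x \<in> ?R" if "x \<in> ?R" for c x
      using that unfolding scaleR_eq_scale by (auto simp flip: vector_scalar_commute)
  qed
  hence cl: "closed ?R" by (rule closed_subspace)
  have "x \<in> ?R" for x
  proof -
    have "vac x \<in> closure (gen_space n T 0)"
      using assms outer_iff_dense [OF T] in_fock_op_app [OF is_op_id_op] by blast
    then obtain f where f: "\<And>i. f i \<in> gen_space n T 0" "f \<longlonglongrightarrow> vac x"
      unfolding closure_sequential by blast
    have "coord (f i) [] \<in> ?R" for i
      using f(1) [of i] coord_mop_Nil [OF T] is_poly_fin_supp unfolding gen_space_def by fastforce
    moreover have "(\<lambda>i. coord (f i) []) \<longlonglongrightarrow> x"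
      using tendsto_coord [OF f(2), of "[]"] by (simp add: coord_vac)
    ultimately show ?thesis by (rule closed_sequentially [OF cl])
  qed
  thus ?thesis unfolding invertible_iff_surj by (metis imageE)
qed

lemma outer_iff_wandering:
  fixes T L :: "nat list \<Rightarrow> complex^'m::finite^'m"
  assumes T: "is_op n T" and L: "wandering_part n T L"
  shows "outer n T \<longleftrightarrow> invertible (T []) \<and> (\<forall>h. norm (op_app L h) = norm (T [] *v h))"
proof (intro iffI conjI allI)
  assume outer: "outer n T"
  show "invertible (T [])" using outer_imp_invertible [OF T outer] .
  fix h
  define d where "d = op_app L h - vac (T [] *v h)"
  have "op_app T h - vac (T [] *v h) \<in> closure (gen_space n T 1)"
    by (intro outer_dense_tail [OF T outer] in_fock_diff in_fock_op_app T is_op_id_op)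
       (simp add: coord_vac coord_op_app [OF T])
  from subspace_diff [OF subspace_closure_gen_space this wandering_diff [OF T L, of h]]
  have d: "d \<in> closure (gen_space n T 1)" by (simp add: d_def)
  have "inner (op_app L h) d = 0" using wandering_orthogonal [OF T L d] .
  moreover have "inner d (vac (T [] *v h)) = 0"
    using coord_closure_gen_space [OF d, of "[]"] by (simp add: inner_vac)
  ultimately have "inner d d = 0"
    by (simp add: d_def inner_diff_left inner_diff_right inner_commute)
  hence "op_app L h = vac (T [] *v h)" by (simp add: d_def)
  thus "norm (op_app L h) = norm (T [] *v h)" by (simp add: norm_vac)
next
  assume *: "invertible (T []) \<and> (\<forall>h. norm (op_app L h) = norm (T [] *v h))"
  have vac: "vac x \<in> closure (gen_space n T 0)" for x
  proof -
    obtain h where h: "T [] *v h = x" using * invertible_iff_surj by blast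
    have "inner (op_app L h) (vac x) = (norm x)\<^sup>2"
      using h by (simp add: inner_vac coord_wandering_Nil [OF T L] power2_norm_eq_inner)
    moreover have "(norm (op_app L h - vac x))\<^sup>2
        = (norm (op_app L h))\<^sup>2 - 2 * inner (op_app L h) (vac x) + (norm (vac x))\<^sup>2"
      unfolding power2_norm_eq_inner by (simp add: inner_diff_left inner_diff_right inner_commute)
    ultimately have "(norm (op_app L h - vac x))\<^sup>2 = 0" using * h by (simp add: norm_vac)
    hence "vac x = op_app L h" by simp
    also have "\<dots> \<in> closure (gen_space n T 0)" by (rule wandering_in_closure [OF T L])
    finally show ?thesis .
  qed
  have "gen_space n id_op 0 \<subseteq> closure (gen_space n T 0)"
  proof
    fix u :: "'m fock" assume "u \<in> gen_space n id_op 0"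
    then obtain p where p: "is_poly n p" "u = emb p" unfolding gen_space_def by blast
    show "u \<in> closure (gen_space n T 0)"
      unfolding p(2) mop_def
    proof (rule subspace_sum [OF subspace_closure_gen_space])
      fix \<alpha> assume "\<alpha> \<in> {\<alpha>. p \<alpha> \<noteq> 0}"
      hence "\<alpha> \<in> Wds n" using p(1) by (auto simp: is_poly_def)
      from closure_gen_space_mono [OF _ closure_gen_space_shift [OF vac this]]
      show "shift \<alpha> (vac (p \<alpha>)) \<in> closure (gen_space n T 0)" by simp
    qed
  qed
  hence "closure (gen_space n id_op 0) \<subseteq> closure (gen_space n T 0)"
    by (rule closure_minimal) simp
  thus "outer n T" unfolding outer_iff_dense [OF T] using emb_dense by blast
qed

lemma Delta_eq_iff_wandering:
  assumes T: "is_op n T" and L: "wandering_part n T L"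
  shows "Delta n (kernel T) = cadj (T []) ** T [] \<longleftrightarrow> (\<forall>h. norm (op_app L h) = norm (T [] *v h))"
proof
  assume "Delta n (kernel T) = cadj (T []) ** T []"
  hence "cinner (kernel L [] [] *v h) h = cinner (cadj (T []) ** T [] *v h) h" for h
    by (simp add: Delta_eq_kernel [OF T L])
  hence "(norm (op_app L h))\<^sup>2 = (norm (T [] *v h))\<^sup>2" for h
    unfolding cinner_kernel_wandering [OF T L] cinner_cadj_mult_self of_real_eq_iff .
  thus "\<forall>h. norm (op_app L h) = norm (T [] *v h)" by (simp add: power2_eq_iff_nonneg)
next
  assume "\<forall>h. norm (op_app L h) = norm (T [] *v h)"
  thus "Delta n (kernel T) = cadj (T []) ** T []"
    unfolding Delta_eq_kernel [OF T L]
    by (intro hermitian_form_unique) (simp only: cinner_kernel_wandering [OF T L] cinner_cadj_mult_self)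
qed

lemma outer_iff_Delta:
  assumes T: "is_op n T"
  shows "outer n T \<longleftrightarrow> invertible (T []) \<and> Delta n (kernel T) = cadj (T []) ** T []"
proof -
  obtain L where L: "wandering_part n T L" using ex_wandering_part [OF T] by blast
  show ?thesis unfolding outer_iff_wandering [OF T L] Delta_eq_iff_wandering [OF T L] ..
qed

lemma det_cadj: "det (cadj A) = cnj (det A)"
proof -
  have "det (cadj A) = det (\<chi> i j. cnj (A$i$j))" unfolding cadj_def by (rule det_transpose)
  also have "\<dots> = cnj (det A)" by (simp add: det_def)
  finally show ?thesis .
qed

lemma det_cadj_mult_self: "det (cadj A ** A) = complex_of_real ((cmod (det A))\<^sup>2)"
  unfolding det_mul det_cadj by (metis complex_norm_square mult.commute)

lemma outer_iff_eK:
  assumes T: "is_op n T"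
  shows "outer n T \<longleftrightarrow> invertible (T []) \<and>
    eK n (kernel T) = ereal (ln (Re (det (cadj (T []) ** T []))))"
proof
  assume "outer n T"
  hence *: "invertible (T [])" "Delta n (kernel T) = cadj (T []) ** T []"
    using outer_iff_Delta [OF T] by auto
  hence "Re (det (cadj (T []) ** T [])) > 0" by (simp add: det_cadj_mult_self invertible_det_nz)
  thus "invertible (T []) \<and> eK n (kernel T) = ereal (ln (Re (det (cadj (T []) ** T []))))"
    using * by (simp add: eK_def)
next
  let ?B = "cadj (T []) ** T []"
  assume *: "invertible (T []) \<and> eK n (kernel T) = ereal (ln (Re (det ?B)))"
  obtain L where L: "wandering_part n T L" using ex_wandering_part [OF T] by blast
  define A where "A = kernel L [] []"
  have A: "Delta n (kernel T) = A" unfolding A_def by (rule Delta_eq_kernel [OF T L])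
  have B0: "Re (det ?B) > 0" using * by (simp add: det_cadj_mult_self invertible_det_nz)
  have eq: "Re (det A) = Re (det ?B)"
    using * B0 by (auto simp: eK_def A split: if_splits)
  have "A - ?B = 0"
  proof (rule ccontr)
    assume "A - ?B \<noteq> 0"
    moreover have "Im (cinner (?B *v h) h) = 0 \<and> 0 < Re (cinner (?B *v h) h)" if "h \<noteq> 0" for h
      using * that unfolding cinner_cadj_mult_self by (auto simp: invertible_iff_inj)
    moreover have "psd (A - ?B)"
      unfolding psd_def matrix_vector_mult_diff_rdistrib cinner_diff_left A_def
        cinner_kernel_wandering [OF T L] cinner_cadj_mult_self
      using norm_le_wandering [OF T L] by (auto intro: power_mono)
    ultimately obtain c where c: "c > 1" "det (?B + (A - ?B)) = complex_of_real c * det ?B"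
      using det_strict_mono [of ?B "A - ?B"] by blast
    hence "Re (det A) = c * Re (det ?B)" by simp
    hence "Re (det ?B) * (c - 1) = 0" using eq by (simp add: algebra_simps)
    thus False using B0 c(1) by simp
  qed
  hence "A = ?B" by simp
  thus "outer n T" using * A outer_iff_Delta [OF T] by simp
qed

section \<open>Operators with the same kernel\<close>

lemma kernel_eq_iff_norm_eq:
  fixes T P :: "nat list \<Rightarrow> complex^'m::finite^'m"
  assumes T: "is_op n T" and P: "is_op n P"
  shows "(\<forall>\<sigma>\<in>Wds n. \<forall>\<omega>\<in>Wds n. kernel P \<sigma> \<omega> = kernel T \<sigma> \<omega>) \<longleftrightarrow>
    (\<forall>p. is_poly n p \<longrightarrow> norm (mop P p) = norm (mop T p))"
proof (intro iffI allI ballI impI)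
  fix p :: "nat list \<Rightarrow> complex^'m"
  assume k: "\<forall>\<sigma>\<in>Wds n. \<forall>\<omega>\<in>Wds n. kernel P \<sigma> \<omega> = kernel T \<sigma> \<omega>" and p: "is_poly n p"
  define F where "F = {\<alpha>. p \<alpha> \<noteq> 0}"
  have F: "finite F" "F \<subseteq> Wds n" "\<And>\<sigma>. \<sigma> \<notin> F \<Longrightarrow> p \<sigma> = 0" using p by (auto simp: F_def is_poly_def)
  have "(\<Sum>\<sigma>\<in>F. \<Sum>\<omega>\<in>F. cinner (kernel P \<omega> \<sigma> *v p \<sigma>) (p \<omega>)) = (\<Sum>\<sigma>\<in>F. \<Sum>\<omega>\<in>F. cinner (kernel T \<omega> \<sigma> *v p \<sigma>) (p \<omega>))"
    using k F(2) by (intro sum.cong refl) (metis subsetD)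
  hence "(norm (mop P p))\<^sup>2 = (norm (mop T p))\<^sup>2"
    using kernel_form_eq_norm [OF T F(1), of p, OF F(3)] kernel_form_eq_norm [OF P F(1), of p, OF F(3)]
    by simp
  thus "norm (mop P p) = norm (mop T p)" by (simp add: power2_eq_iff_nonneg)
next
  fix \<sigma> \<omega> assume nrm: "\<forall>p. is_poly n p \<longrightarrow> norm (mop P p) = norm (mop T p)" and w: "\<sigma> \<in> Wds n" "\<omega> \<in> Wds n"
  have pol: "inner (mop S p) (mop S q) = ((norm (mop S (\<lambda>\<alpha>. p \<alpha> + q \<alpha>)))\<^sup>2 - (norm (mop S p))\<^sup>2 - (norm (mop S q))\<^sup>2) / 2"
    if "is_poly n p" "is_poly n q" for S p q
    using that by (simp add: dot_norm mop_add is_poly_fin_supp)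
  have inn: "inner (mop P p) (mop P q) = inner (mop T p) (mop T q)" if "is_poly n p" "is_poly n q" for p q
    using that nrm by (simp add: pol is_poly_add)
  have "cin (mop P p) (mop P q) = cin (mop T p) (mop T q)" if pq: "is_poly n p" "is_poly n q" for p q
    using inn [OF pq] inn [OF pq(1) is_poly_scale [OF pq(2), of \<i>]]
    by (simp add: cin_eq mop_scale is_poly_fin_supp [OF pq(2)])
  hence "cin (mop P (pt \<omega> (axis j 1))) (mop P (pt \<sigma> (axis i 1))) = cin (mop T (pt \<omega> (axis j 1))) (mop T (pt \<sigma> (axis i 1)))" for i j
    using w by (simp add: is_poly_pt)
  thus "kernel P \<sigma> \<omega> = kernel T \<sigma> \<omega>"
    unfolding mop_pt op_app_axis by (simp add: vec_eq_iff kernel_entry [OF T] kernel_entry [OF P])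
qed

lift_definition trunc :: "nat \<Rightarrow> 'm::finite fock \<Rightarrow> 'm fock" is "\<lambda>k u. Pk k u"
  by (erule summable_on_comparison_test) (auto simp: Pk_def)

declare trunc.rep_eq [simp]

lemma norm_trunc_le:
  assumes "\<And>\<alpha>. length \<alpha> \<le> k \<Longrightarrow> coord g \<alpha> = 0"
  shows "norm (trunc k u) \<le> norm (u - g)"
proof -
  have "inner (trunc k u) (u - g - trunc k u) = 0"
    using assms by (intro ell2_orthogonal_if_disjoint) (auto simp: Pk_def)
  hence "(norm (u - g))\<^sup>2 = (norm (trunc k u))\<^sup>2 + (norm (u - g - trunc k u))\<^sup>2"
    using norm_add_Pythagorean [of "trunc k u" "u - g - trunc k u"] by (simp add: orthogonal_def)
  thus ?thesis by (simp add: power2_le_imp_le)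
qed

lemma in_Pk_imp_is_poly:
  assumes "in_Pk n k p" shows "is_poly n p"
proof -
  have "finite {\<alpha>. set \<alpha> \<subseteq> {..<n} \<and> length \<alpha> \<le> k}" by (rule finite_lists_length_le) simp
  moreover have "{\<alpha>. p \<alpha> \<noteq> 0} \<subseteq> {\<alpha>. set \<alpha> \<subseteq> {..<n} \<and> length \<alpha> \<le> k}"
    using assms by (auto simp: in_Pk_def Wds_def)
  ultimately show ?thesis using assms unfolding is_poly_def
    by (auto simp: in_Pk_def intro: finite_subset)
qed

lemma l2norm_Pk_Mpoly: "is_op n T \<Longrightarrow> l2norm (Pk k (Mpoly T p)) = norm (trunc k (mop T p))"
  by (simp flip: l2norm_coord add: coord_mop)

lemma outer_norm_trunc_maximal:
  assumes T: "is_op n T" and outer: "outer n T"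
    and nrm: "\<And>p. is_poly n p \<Longrightarrow> norm (mop P p) = norm (mop T p)" and p: "is_poly n p"
  shows "norm (trunc k (mop P p)) \<le> norm (trunc k (mop T p))"
proof (rule field_le_epsilon)
  fix e :: real assume e: "e > 0"
  let ?v = "mop T p - trunc k (mop T p)"
  have "in_fock n ?v" using in_fock_mop [OF T p] by (auto simp: in_fock_def Pk_def)
  hence "?v \<in> closure (gen_space n T (Suc k))"
    by (intro outer_dense_tail [OF T outer]) (auto simp: Pk_def)
  then obtain g where g: "g \<in> gen_space n T (Suc k)" "dist g ?v < e"
    using e unfolding closure_approachable by blast
  then obtain q where q: "is_poly n q" "\<forall>\<alpha>. length \<alpha> < Suc k \<longrightarrow> q \<alpha> = 0" "g = mop T q"
    unfolding gen_space_def by blast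
  have "mop P q \<in> gen_space n P (Suc k)" using q by (intro mop_in_gen_space) auto
  hence "norm (trunc k (mop P p)) \<le> norm (mop P p - mop P q)"
    by (intro norm_trunc_le) (auto intro: coord_gen_space)
  also have "\<dots> = norm (mop T p - g)"
    using nrm [OF is_poly_diff [OF p q(1)]] p q by (simp add: mop_diff is_poly_fin_supp)
  also have "\<dots> \<le> norm (trunc k (mop T p)) + norm (?v - g)"
    using norm_triangle_ineq [of "trunc k (mop T p)" "?v - g"] by simp
  also have "\<dots> \<le> norm (trunc k (mop T p)) + e" using g(2) by (simp add: dist_norm norm_minus_commute)
  finally show "norm (trunc k (mop P p)) \<le> norm (trunc k (mop T p)) + e" .
qed

section \<open>The outer factor\<close>

lemma inner_shift: "inner (shift \<omega> u) (shift \<omega> v) = inner u v"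
  unfolding dot_norm by (simp flip: shift_add)

lemma inner_shift_incomparable:
  assumes "take (length \<alpha>) \<beta> \<noteq> \<alpha>" "length \<alpha> \<le> length \<beta>"
  shows "inner (shift \<alpha> u) (shift \<beta> v) = 0"
proof (rule ell2_orthogonal_if_disjoint)
  fix x
  have "take (length \<alpha>) x \<noteq> \<alpha> \<or> take (length \<beta>) x \<noteq> \<beta>"
    using assms by (metis min_absorb1 take_take)
  thus "coord (shift \<alpha> u) x = 0 \<or> coord (shift \<beta> v) x = 0" by (auto simp: shiftS_def)
qed

lemma op_app_sum: "op_app T (\<Sum>i\<in>I. f i) = (\<Sum>i\<in>I. op_app T (f i))"
  by (induction I rule: infinite_finite_induct) (auto simp: op_app_add)

context
  fixes n :: nat and T L :: "nat list \<Rightarrow> complex^'m::finite^'m"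
  assumes T: "is_op n T" and L: "wandering_part n T L"
begin

lemma wandering_shift_orthogonal:
  assumes v: "v \<in> closure (gen_space n T 0)" and w: "\<beta> \<in> Wds n" and len: "length \<alpha> < length \<beta>"
  shows "inner (shift \<alpha> (op_app L h)) (shift \<beta> v) = 0"
proof (cases "take (length \<alpha>) \<beta> = \<alpha>")
  case True
  define \<gamma> where "\<gamma> = drop (length \<alpha>) \<beta>"
  have \<beta>: "\<beta> = \<alpha> @ \<gamma>" using True by (metis \<gamma>_def append_take_drop_id)
  have \<gamma>: "\<gamma> \<in> Wds n" "1 \<le> length \<gamma>" using w len by (auto simp: \<beta> Suc_le_eq)
  have "shift \<gamma> v \<in> closure (gen_space n T 1)"
    using closure_gen_space_mono [OF _ closure_gen_space_shift [OF v \<gamma>(1)], of 1] \<gamma>(2) by simp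
  thus ?thesis unfolding \<beta> shift_shift [symmetric] inner_shift by (rule wandering_orthogonal [OF T L])
next
  case False
  thus ?thesis using len by (intro inner_shift_incomparable) auto
qed

text \<open>By the Cholesky factorization \<open>R\<close> of the Gram matrix, the columns of \<open>V\<close> form an orthonormal basis
  of the wandering subspace.\<close>

lemma ex_inner_factor:
  assumes inv: "invertible (T [])"
  shows "\<exists>V R. is_op n V \<and> (\<forall>h. norm (op_app V h) = norm h) \<and> (\<forall>h. op_app V (R *v h) = op_app L h)
    \<and> (\<forall>h. \<exists>g. op_app V h = op_app L g)"
proof -
  have "psd (kernel L [] [])"
    unfolding psd_def cinner_kernel_wandering [OF T L] by simp
  then obtain R where R: "cadj R ** R = kernel L [] []"
    using ex_cholesky [of UNIV "kernel L [] []"] by auto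
  have "complex_of_real ((norm (R *v h))\<^sup>2) = complex_of_real ((norm (op_app L h))\<^sup>2)" for h
    by (simp only: R cinner_kernel_wandering [OF T L, symmetric] cinner_cadj_mult_self [symmetric])
  hence nR: "norm (R *v h) = norm (op_app L h)" for h
    unfolding of_real_eq_iff by (simp add: power2_eq_iff_nonneg)
  have "x = 0" if "R *v x = 0" for x
    using norm_le_wandering [OF T L, of x] nR [of x] that inv by (simp add: invertible_iff_inj)
  hence "invertible R" by (simp add: invertible_iff_inj)
  then obtain Q where Q: "R ** Q = mat 1" "Q ** R = mat 1" unfolding invertible_def by blast
  define V where "V = op_of_cols (\<lambda>j. op_app L (Q *v axis j 1))"
  have V: "op_app V h = op_app L (Q *v h)" for h
  proof -
    have "op_app L (Q *v h) = op_app L (\<Sum>j\<in>UNIV. h$j *s (Q *v axis j 1))"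
      by (simp add: matrix_vector_mult_columns [of Q h] matrix_vector_mult_axis)
    thus ?thesis by (simp add: V_def op_app_op_of_cols op_app_sum op_app_scale)
  qed
  have "is_op n V" unfolding V_def
    by (intro is_op_op_of_cols in_fock_op_app is_op_wandering [OF T L])
  moreover have "norm (op_app V h) = norm h" for h
    by (simp add: V matrix_vector_mul_assoc Q flip: nR)
  moreover have "op_app V (R *v h) = op_app L h" for h
    by (simp add: V matrix_vector_mul_assoc Q)
  ultimately show ?thesis using V by blast
qed

context
  fixes V :: "nat list \<Rightarrow> complex^'m^'m" and R :: "complex^'m^'m"
  assumes V: "is_op n V" and norm_V: "\<And>h. norm (op_app V h) = norm h"
    and VR: "\<And>h. op_app V (R *v h) = op_app L h" and V_in: "\<And>h. \<exists>g. op_app V h = op_app L g"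
begin

lemma isometry_inner_factor:
  assumes p: "is_poly n p" shows "norm (mop V p) = norm (emb p)"
proof -
  have fs: "fin_supp p" using p by (rule is_poly_fin_supp)
  have orth: "inner (shift \<alpha> (op_app V g)) (shift \<beta> (op_app V h)) = 0"
    if "\<alpha> \<noteq> \<beta>" "\<alpha> \<in> Wds n" "\<beta> \<in> Wds n" "length \<alpha> \<le> length \<beta>" for \<alpha> \<beta> g h
  proof (cases "length \<alpha> < length \<beta>")
    case True
    obtain g' h' where "op_app V g = op_app L g'" "op_app V h = op_app L h'" using V_in by blast
    thus ?thesis using wandering_shift_orthogonal [OF wandering_in_closure [OF T L] that(3) True] by simp
  next
    case False
    thus ?thesis using that by (intro inner_shift_incomparable) auto
  qed
  have "(norm (mop V p))\<^sup>2 = (\<Sum>\<alpha> | p \<alpha> \<noteq> 0. (norm (shift \<alpha> (op_app V (p \<alpha>))))\<^sup>2)"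
    unfolding mop_def
  proof (rule norm_sum_Pythagorean [OF fs])
    show "pairwise (\<lambda>\<alpha> \<beta>. orthogonal (shift \<alpha> (op_app V (p \<alpha>))) (shift \<beta> (op_app V (p \<beta>)))) {\<alpha>. p \<alpha> \<noteq> 0}"
      unfolding pairwise_def orthogonal_def
    proof (intro ballI impI)
      fix \<alpha> \<beta> assume "\<alpha> \<in> {\<alpha>. p \<alpha> \<noteq> 0}" "\<beta> \<in> {\<alpha>. p \<alpha> \<noteq> 0}" "\<alpha> \<noteq> \<beta>"
      moreover from this have "\<alpha> \<in> Wds n" "\<beta> \<in> Wds n" using p by (auto simp: is_poly_def)
      ultimately show "inner (shift \<alpha> (op_app V (p \<alpha>))) (shift \<beta> (op_app V (p \<beta>))) = 0"
        using orth [of \<alpha> \<beta> "p \<alpha>" "p \<beta>"] orth [of \<beta> \<alpha> "p \<beta>" "p \<alpha>"]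
        by (cases "length \<alpha> \<le> length \<beta>") (auto simp: inner_commute)
    qed
  qed
  also have "\<dots> = (norm (emb p))\<^sup>2" by (simp add: norm_emb [OF fs] norm_V)
  finally show ?thesis by (simp add: power2_eq_iff_nonneg)
qed

definition head_space :: "nat \<Rightarrow> 'm fock set" where
  "head_space k = span {shift \<alpha> (op_app V h) | \<alpha> h. \<alpha> \<in> Wds n \<and> length \<alpha> < k}"

lemma head_space_subset: "head_space k \<subseteq> gen_space n V 0"
  unfolding head_space_def
proof (rule span_minimal [OF _ subspace_gen_space], clarify)
  fix \<alpha> and h :: "complex^'m" assume "\<alpha> \<in> Wds n"
  thus "shift \<alpha> (op_app V h) \<in> gen_space n V 0"
    using mop_in_gen_space [OF is_poly_pt, of \<alpha> n 0 h V] by (simp add: mop_pt)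
qed

lemma head_space_orthogonal:
  assumes a: "a \<in> head_space k" and g: "g \<in> gen_space n T k" shows "inner g a = 0"
proof -
  obtain p where p: "is_poly n p" "\<forall>\<alpha>. length \<alpha> < k \<longrightarrow> p \<alpha> = 0" "g = mop T p"
    using g unfolding gen_space_def by blast
  have *: "inner (shift \<alpha> (op_app V h)) g = 0" if "length \<alpha> < k" for \<alpha> h
    unfolding p(3) mop_def inner_sum_right
  proof (intro sum.neutral ballI)
    fix \<beta> assume "\<beta> \<in> {\<beta>. p \<beta> \<noteq> 0}"
    hence "\<beta> \<in> Wds n" "length \<alpha> < length \<beta>" using p that by (auto simp: is_poly_def) (meson not_less order_less_le_trans)
    thus "inner (shift \<alpha> (op_app V h)) (shift \<beta> (op_app T (p \<beta>))) = 0"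
      using V_in [of h] op_app_in_gen_space [of T "p \<beta>" n] closure_subset
        wandering_shift_orthogonal [of "op_app T (p \<beta>)" \<beta> \<alpha>] by fastforce
  qed
  have "orthogonal g a"
    using a unfolding head_space_def
    by (rule orthogonal_to_span) (auto simp: orthogonal_def inner_commute [of g] *)
  thus ?thesis by (simp add: orthogonal_def)
qed

definition split_space :: "nat \<Rightarrow> 'm fock set" where
  "split_space k = {a + g | a g. a \<in> head_space k \<and> g \<in> gen_space n T k}"

lemma subspace_split_space: "subspace (split_space k)"
  unfolding split_space_def head_space_def
  using subspace_sums [OF subspace_span subspace_gen_space] by simp

lemma head_in_split: "a \<in> head_space k \<Longrightarrow> a \<in> split_space k"
  unfolding split_space_def using subspace_0 [OF subspace_gen_space] by force

lemma gen_in_split: "g \<in> gen_space n T k \<Longrightarrow> g \<in> split_space k"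
  unfolding split_space_def head_space_def using span_zero by force

lemma split_space_step: "split_space k \<subseteq> closure (split_space (Suc k))"
proof
  fix u assume "u \<in> split_space k"
  then obtain a p where a: "a \<in> head_space k" and p: "is_poly n p" "\<forall>\<alpha>. length \<alpha> < k \<longrightarrow> p \<alpha> = 0"
    and u: "u = a + mop T p"
    unfolding split_space_def gen_space_def by blast
  note sub = subspace_closure [OF subspace_split_space]
  have "head_space k \<subseteq> head_space (Suc k)" unfolding head_space_def by (rule span_mono) auto
  hence "a \<in> closure (split_space (Suc k))" using a head_in_split closure_subset by blast
  moreover have "mop T p \<in> closure (split_space (Suc k))"
    unfolding mop_def
  proof (rule subspace_sum [OF sub])
    fix \<alpha> assume "\<alpha> \<in> {\<alpha>. p \<alpha> \<noteq> 0}"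
    hence \<alpha>: "\<alpha> \<in> Wds n" "length \<alpha> \<ge> k" using p by (auto simp: is_poly_def not_less [symmetric])
    show "shift \<alpha> (op_app T (p \<alpha>)) \<in> closure (split_space (Suc k))"
    proof (cases "length \<alpha> = k")
      case True
      have "shift \<alpha> (op_app L (p \<alpha>)) \<in> head_space (Suc k)"
        unfolding head_space_def VR [symmetric] using \<alpha> True by (intro span_base) auto
      hence "shift \<alpha> (op_app L (p \<alpha>)) \<in> closure (split_space (Suc k))"
        using head_in_split closure_subset by blast
      moreover have "shift \<alpha> (op_app T (p \<alpha>) - op_app L (p \<alpha>)) \<in> closure (gen_space n T (Suc k))"
        using closure_gen_space_shift [OF wandering_diff [OF T L] \<alpha>(1)] True by simp
      moreover have "closure (gen_space n T (Suc k)) \<subseteq> closure (split_space (Suc k))"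
        by (rule closure_mono) (use gen_in_split in blast)
      ultimately have "shift \<alpha> (op_app L (p \<alpha>)) + shift \<alpha> (op_app T (p \<alpha>) - op_app L (p \<alpha>)) \<in> closure (split_space (Suc k))"
        by (intro subspace_add [OF sub]) auto
      thus ?thesis by (simp add: shift_diff)
    next
      case False
      have "shift \<alpha> (op_app T (p \<alpha>)) \<in> gen_space n T (Suc k)"
        using gen_space_shift [OF op_app_in_gen_space \<alpha>(1), of T "p \<alpha>"]
          gen_space_mono [of "Suc k" "length \<alpha>" n T] \<alpha>(2) False
        by auto
      thus ?thesis using gen_in_split closure_subset by blast
    qed
  qed
  ultimately show "u \<in> closure (split_space (Suc k))" unfolding u by (rule subspace_add [OF sub])
qed

lemma gen_space_subset_split: "gen_space n T 0 \<subseteq> closure (split_space k)"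
proof (induction k)
  case 0
  show ?case using gen_in_split closure_subset by blast
next
  case (Suc k)
  thus ?case using closure_minimal [OF split_space_step closed_closure, of k] by blast
qed

text \<open>The part \<open>g\<close> of order at least \<open>k\<close> is orthogonal to the head and to polynomials of degree
  less than \<open>k\<close>, so its norm is controlled by the tail of \<open>u\<close>.\<close>

lemma gen_space_subset_closure_inner: "gen_space n T 0 \<subseteq> closure (gen_space n V 0)"
proof
  fix u assume u: "u \<in> gen_space n T 0"
  show "u \<in> closure (gen_space n V 0)"
    unfolding closure_approachable
  proof (intro allI impI)
    fix e :: real assume "e > 0"
    hence e: "e / 3 > 0" by simp
    have "in_fock n u" using in_fock_gen_space [OF T u] .
    from emb_dense [OF this] obtain v where "v \<in> gen_space n id_op 0" and dv: "dist v u < e / 3"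
      using e unfolding closure_approachable by blast
    then obtain r where r: "is_poly n r" "v = emb r" unfolding gen_space_def by blast
    note fr = is_poly_fin_supp [OF r(1)]
    define k where "k = Suc (Max (insert 0 (length ` {\<alpha>. r \<alpha> \<noteq> 0})))"
    have k: "length \<alpha> < k" if "r \<alpha> \<noteq> 0" for \<alpha>
      unfolding k_def using fr that by (intro le_imp_less_Suc Max_ge) auto
    have "u \<in> closure (split_space k)" using gen_space_subset_split u by blast
    then obtain y where y: "y \<in> split_space k" "dist y u < e / 3"
      using e unfolding closure_approachable by blast
    then obtain a g where ag: "a \<in> head_space k" "g \<in> gen_space n T k" "y = a + g"
      unfolding split_space_def by blast
    have "inner g v = 0"
      unfolding r(2) using coord_gen_space [OF ag(2)] k
      by (intro ell2_orthogonal_if_disjoint) (auto simp: coord_emb [OF fr])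
    hence "inner g g = inner g (u - v) - inner g (u - y)"
      using head_space_orthogonal [OF ag(1,2)] by (simp add: ag(3) inner_diff_right inner_add_right)
    also have "\<dots> \<le> norm g * norm (u - v) + norm g * norm (u - y)"
      using Cauchy_Schwarz_ineq2 [of g "u - v"] Cauchy_Schwarz_ineq2 [of g "u - y"] by linarith
    finally have "norm g * norm g \<le> norm g * (norm (u - v) + norm (u - y))"
      by (simp add: distrib_left power2_eq_square flip: power2_norm_eq_inner)
    hence "norm g \<le> norm (u - v) + norm (u - y)"
      by (cases "g = 0") (auto simp: mult_le_cancel_left)
    moreover have "norm (u - a) \<le> norm (u - y) + norm g"
      using norm_triangle_ineq [of "u - y" g] by (simp add: ag(3))
    ultimately have "dist a u < e"
      using dv y(2) by (simp add: dist_norm norm_minus_commute)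
    thus "\<exists>y\<in>gen_space n V 0. dist y u < e" using head_space_subset ag(1) by blast
  qed
qed

text \<open>The graph of the isometric extension of \<open>emb p \<mapsto> mop V p\<close>.\<close>

definition inner_graph :: "'m fock \<Rightarrow> 'm fock \<Rightarrow> bool" where
  "inner_graph x y \<longleftrightarrow> (\<exists>q. (\<forall>i. is_poly n (q i)) \<and> (\<lambda>i::nat. emb (q i)) \<longlonglongrightarrow> x \<and> (\<lambda>i. mop V (q i)) \<longlonglongrightarrow> y)"

lemma inner_graph_poly: "is_poly n p \<Longrightarrow> inner_graph (emb p) (mop V p)"
  unfolding inner_graph_def by (rule exI [of _ "\<lambda>_. p"]) auto

lemma inner_graph_add:
  assumes "inner_graph x y" "inner_graph x' y'" shows "inner_graph (x + x') (y + y')"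
proof -
  obtain p q where p: "\<And>i. is_poly n (p i)" "(\<lambda>i. emb (p i)) \<longlonglongrightarrow> x" "(\<lambda>i. mop V (p i)) \<longlonglongrightarrow> y"
    and q: "\<And>i. is_poly n (q i)" "(\<lambda>i. emb (q i)) \<longlonglongrightarrow> x'" "(\<lambda>i. mop V (q i)) \<longlonglongrightarrow> y'"
    using assms unfolding inner_graph_def by blast
  have *: "mop S (\<lambda>\<alpha>. p i \<alpha> + q i \<alpha>) = mop S (p i) + mop S (q i)" for S i
    using p(1) q(1) by (intro mop_add is_poly_fin_supp)
  show ?thesis
    unfolding inner_graph_def
    by (rule exI [of _ "\<lambda>i \<alpha>. p i \<alpha> + q i \<alpha>"]) (auto simp: * intro!: is_poly_add tendsto_add p q)
qed

lemma inner_graph_cscale: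
  assumes "inner_graph x y" shows "inner_graph (cscale c x) (cscale c y)"
proof -
  obtain p where p: "\<And>i. is_poly n (p i)" "(\<lambda>i. emb (p i)) \<longlonglongrightarrow> x" "(\<lambda>i. mop V (p i)) \<longlonglongrightarrow> y"
    using assms unfolding inner_graph_def by blast
  have *: "mop S (\<lambda>\<alpha>. c *s p i \<alpha>) = cscale c (mop S (p i))" for S i
    using p(1) by (intro mop_scale is_poly_fin_supp)
  show ?thesis
    unfolding inner_graph_def
    by (rule exI [of _ "\<lambda>i \<alpha>. c *s p i \<alpha>"])
       (auto simp: * intro!: is_poly_scale bounded_linear.tendsto [OF bounded_linear_cscale] p)
qed

lemma inner_graph_shift:
  assumes "inner_graph x y" "\<omega> \<in> Wds n" shows "inner_graph (shift \<omega> x) (shift \<omega> y)"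
proof -
  obtain p where p: "\<And>i. is_poly n (p i)" "(\<lambda>i. emb (p i)) \<longlonglongrightarrow> x" "(\<lambda>i. mop V (p i)) \<longlonglongrightarrow> y"
    using assms unfolding inner_graph_def by blast
  show ?thesis
    unfolding inner_graph_def
    by (rule exI [of _ "\<lambda>i. shiftS \<omega> (p i)"])
       (auto simp: mop_shiftS intro!: is_poly_shiftS assms bounded_linear.tendsto [OF bounded_linear_shift] p)
qed

lemma inner_graph_sum:
  "(\<And>i. i \<in> I \<Longrightarrow> inner_graph (f i) (g i)) \<Longrightarrow> inner_graph (\<Sum>i\<in>I. f i) (\<Sum>i\<in>I. g i)"
  using inner_graph_poly [OF is_poly_zero]
  by (induction I rule: infinite_finite_induct) (auto intro: inner_graph_add)

lemma inner_graph_norm: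
  assumes "inner_graph x y" shows "norm x = norm y"
proof -
  obtain p where p: "\<And>i. is_poly n (p i)" "(\<lambda>i. emb (p i)) \<longlonglongrightarrow> x" "(\<lambda>i. mop V (p i)) \<longlonglongrightarrow> y"
    using assms unfolding inner_graph_def by blast
  have "(\<lambda>i. norm (emb (p i))) \<longlonglongrightarrow> norm x" by (intro tendsto_intros p)
  moreover have "(\<lambda>i. norm (mop V (p i))) \<longlonglongrightarrow> norm y" by (intro tendsto_intros p)
  ultimately show ?thesis using p(1) by (simp add: isometry_inner_factor LIMSEQ_unique)
qed

lemma inner_graph_inner:
  assumes "inner_graph x y" "inner_graph x' y'" shows "inner x x' = inner y y'"
  unfolding dot_norm
  using inner_graph_norm [OF assms(1)] inner_graph_norm [OF assms(2)]
    inner_graph_norm [OF inner_graph_add [OF assms]] by simp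

lemma inner_graph_in_fock:
  assumes "inner_graph x y" shows "in_fock n x"
proof -
  obtain p where p: "\<And>i. is_poly n (p i)" "(\<lambda>i. emb (p i)) \<longlonglongrightarrow> x"
    using assms unfolding inner_graph_def by blast
  hence "x \<in> closure (gen_space n id_op 0)"
    unfolding closure_sequential using mop_in_gen_space [where T = id_op and k = 0, OF p(1)]
    by (intro exI [of _ "\<lambda>i. emb (p i)"]) auto
  thus ?thesis using in_fock_closure in_fock_gen_space [OF is_op_id_op] by blast
qed

lemma ex_inner_graph:
  assumes y: "y \<in> closure (gen_space n V 0)" shows "\<exists>x. inner_graph x y"
proof -
  obtain f where f: "\<And>i. f i \<in> gen_space n V 0" "f \<longlonglongrightarrow> y"
    using y unfolding closure_sequential by blast
  have "\<forall>i. \<exists>p. is_poly n p \<and> f i = mop V p" using f(1) unfolding gen_space_def by blast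
  then obtain p where p: "\<And>i. is_poly n (p i)" "\<And>i. f i = mop V (p i)" by metis
  have "dist (emb (p i)) (emb (p j)) = dist (f i) (f j)" for i j
  proof -
    have "norm (mop V (\<lambda>\<alpha>. p i \<alpha> - p j \<alpha>)) = norm (emb (\<lambda>\<alpha>. p i \<alpha> - p j \<alpha>))"
      using p(1) by (intro isometry_inner_factor is_poly_diff)
    moreover have "mop S (\<lambda>\<alpha>. p i \<alpha> - p j \<alpha>) = mop S (p i) - mop S (p j)" for S
      using p(1) by (intro mop_diff is_poly_fin_supp)
    ultimately show ?thesis by (simp add: dist_norm p(2))
  qed
  moreover have "Cauchy f" using f(2) by (rule LIMSEQ_imp_Cauchy)
  ultimately have "Cauchy (\<lambda>i. emb (p i))" unfolding Cauchy_def by simp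
  then obtain x where "(\<lambda>i. emb (p i)) \<longlonglongrightarrow> x" using Cauchy_convergent convergent_def by blast
  moreover have "f = (\<lambda>i. mop V (p i))" using p(2) by auto
  hence "(\<lambda>i. mop V (p i)) \<longlonglongrightarrow> y" using f(2) by simp
  ultimately show ?thesis unfolding inner_graph_def using p(1) by blast
qed

lemma ex_outer_factor_aux:
  "\<exists>P. is_op n P \<and> (\<forall>p. is_poly n p \<longrightarrow> norm (mop P p) = norm (mop T p)) \<and>
    (\<forall>h. norm (op_app L h) \<le> norm (P [] *v h))"
proof -
  have "opcol T j \<in> closure (gen_space n V 0)" for j
    using gen_space_subset_closure_inner op_app_in_gen_space [of T "axis j 1" n] by (auto simp: op_app_axis)
  hence "\<forall>j. \<exists>x. inner_graph x (opcol T j)" using ex_inner_graph by blast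
  then obtain x where x: "\<And>j. inner_graph (x j) (opcol T j)" by metis
  define P where "P = op_of_cols x"
  have P: "is_op n P" unfolding P_def using inner_graph_in_fock [OF x] by (intro is_op_op_of_cols)
  have app: "inner_graph (op_app P h) (op_app T h)" for h
    unfolding P_def op_app_op_of_cols op_app_def [of T] by (intro inner_graph_sum inner_graph_cscale x)
  have "norm (mop P p) = norm (mop T p)" if p: "is_poly n p" for p
    unfolding mop_def
    by (intro inner_graph_norm inner_graph_sum inner_graph_shift app) (use p in \<open>auto simp: is_poly_def\<close>)
  moreover have "norm (op_app L h) \<le> norm (P [] *v h)" for h
  proof -
    have "inner_graph (vac (R *v h)) (op_app L h)"
      using inner_graph_poly [OF is_poly_pt [of "[]" n "R *v h"]] by (simp add: mop_pt VR)
    from inner_graph_inner [OF app [of h] this]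
    have "inner (P [] *v h) (R *v h) = inner (op_app T h) (op_app L h)"
      by (simp add: inner_vac coord_op_app [OF P])
    also have "\<dots> = inner (op_app L h) (op_app L h)"
      using wandering_orthogonal [OF T L wandering_diff [OF T L, of h], of h]
      by (simp add: inner_diff_right inner_commute)
    finally have "norm (op_app L h) * norm (op_app L h) \<le> norm (P [] *v h) * norm (R *v h)"
      using norm_cauchy_schwarz [of "P [] *v h" "R *v h"] by (simp add: dot_square_norm power2_eq_square)
    moreover have "norm (R *v h) = norm (op_app L h)" using norm_V [of "R *v h"] by (simp add: VR)
    ultimately show ?thesis by (cases "op_app L h = 0") (auto simp: mult_le_cancel_right)
  qed
  ultimately show ?thesis using P by blast
qed

end

lemma ex_outer_factor:
  assumes "invertible (T [])"
  shows "\<exists>P. is_op n P \<and> (\<forall>p. is_poly n p \<longrightarrow> norm (mop P p) = norm (mop T p)) \<and>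
    (\<forall>h. norm (op_app L h) \<le> norm (P [] *v h))"
proof -
  obtain V R where "is_op n V" "\<And>h. norm (op_app V h) = norm h" "\<And>h. op_app V (R *v h) = op_app L h"
    "\<And>h. \<exists>g. op_app V h = op_app L g"
    using ex_inner_factor [OF assms] by blast
  thus ?thesis by (rule ex_outer_factor_aux)
qed

end

lemma trunc_shift_op_app:
  assumes "is_op n T" shows "trunc (length \<omega>) (shift \<omega> (op_app T h)) = shift \<omega> (vac (T [] *v h))"
  by (rule ell2_eqI)
     (auto simp: Pk_def shiftS_def coord_op_app [OF assms] coord_vac)

lemma outer_iff_norm_trunc_maximal:
  fixes T :: "nat list \<Rightarrow> complex^'m::finite^'m"
  assumes n: "n \<ge> 1" and T: "is_op n T"
  shows "outer n T \<longleftrightarrow> invertible (T []) \<and>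
    (\<forall>P. is_op n P \<and> (\<forall>\<sigma>\<in>Wds n. \<forall>\<omega>\<in>Wds n. kernel P \<sigma> \<omega> = kernel T \<sigma> \<omega>) \<longrightarrow>
      (\<forall>p. in_Pk n k p \<longrightarrow> l2norm (Pk k (Mpoly P p)) \<le> l2norm (Pk k (Mpoly T p))))"
proof (intro iffI conjI allI impI)
  assume outer: "outer n T"
  show "invertible (T [])" using outer_imp_invertible [OF T outer] .
  fix P :: "nat list \<Rightarrow> complex^'m^'m" and p :: "nat list \<Rightarrow> complex^'m"
  assume P: "is_op n P \<and> (\<forall>\<sigma>\<in>Wds n. \<forall>\<omega>\<in>Wds n. kernel P \<sigma> \<omega> = kernel T \<sigma> \<omega>)" and p: "in_Pk n k p"
  have "norm (mop P q) = norm (mop T q)" if "is_poly n q" for q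
    using kernel_eq_iff_norm_eq [OF T] P that by blast
  from outer_norm_trunc_maximal [where k = k, OF T outer this in_Pk_imp_is_poly [OF p]]
  show "l2norm (Pk k (Mpoly P p)) \<le> l2norm (Pk k (Mpoly T p))"
    using P by (simp add: l2norm_Pk_Mpoly [of n] T)
next
  assume *: "invertible (T []) \<and>
    (\<forall>P. is_op n P \<and> (\<forall>\<sigma>\<in>Wds n. \<forall>\<omega>\<in>Wds n. kernel P \<sigma> \<omega> = kernel T \<sigma> \<omega>) \<longrightarrow>
      (\<forall>p. in_Pk n k p \<longrightarrow> l2norm (Pk k (Mpoly P p)) \<le> l2norm (Pk k (Mpoly T p))))"
  obtain L where L: "wandering_part n T L" using ex_wandering_part [OF T] by blast
  obtain P where P: "is_op n P" "\<forall>p. is_poly n p \<longrightarrow> norm (mop P p) = norm (mop T p)"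
    and LP: "\<And>h. norm (op_app L h) \<le> norm (P [] *v h)"
    using ex_outer_factor [OF T L] * by blast
  define \<omega> where "\<omega> = replicate k (0::nat)"
  have \<omega>: "\<omega> \<in> Wds n" "length \<omega> = k" using n by (auto simp: \<omega>_def Wds_def)
  have "norm (op_app L h) = norm (T [] *v h)" for h
  proof (rule antisym)
    have "in_Pk n k (pt \<omega> h)" using \<omega> by (auto simp: in_Pk_def pt_def split: if_splits)
    hence "l2norm (Pk k (Mpoly P (pt \<omega> h))) \<le> l2norm (Pk k (Mpoly T (pt \<omega> h)))"
      using * P kernel_eq_iff_norm_eq [OF T P(1)] by blast
    hence "norm (P [] *v h) \<le> norm (T [] *v h)"
      using trunc_shift_op_app [OF T, of \<omega> h] trunc_shift_op_app [OF P(1), of \<omega> h]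
      by (simp add: l2norm_Pk_Mpoly [OF T] l2norm_Pk_Mpoly [OF P(1)] mop_pt \<omega> norm_vac)
    thus "norm (op_app L h) \<le> norm (T [] *v h)" using LP [of h] by linarith
  qed (rule norm_le_wandering [OF T L])
  thus "outer n T" using * outer_iff_wandering [OF T L] by blast
qed

lemma is_op_scal: "in_F2 n f \<Longrightarrow> is_op n (scal f)"
proof -
  have "(norm (scal f \<alpha>))\<^sup>2 = (cmod (f \<alpha>))\<^sup>2" for \<alpha>
    by (simp add: scal_def norm_vec_def L2_set_def)
  thus "in_F2 n f \<Longrightarrow> is_op n (scal f)"
    unfolding in_F2_def is_op_def by (auto simp: scal_def vec_eq_iff)
qed

theorem mainTheorem9:
  fixes n k :: nat and T :: "nat list \<Rightarrow> complex^'m^'m" and f :: "nat list \<Rightarrow> complex"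
  assumes "n \<ge> 1" and "is_op n T"
  shows "(outer n T \<longleftrightarrow>
            invertible (T []) \<and>
            (\<forall>\<psi>::nat list \<Rightarrow> complex^'m^'m. is_op n \<psi> \<and>
               (\<forall>\<sigma>\<in>Wds n. \<forall>\<omega>\<in>Wds n. kernel \<psi> \<sigma> \<omega> = kernel T \<sigma> \<omega>) \<longrightarrow>
               (\<forall>hp. in_Pk n k hp \<longrightarrow> l2norm (Pk k (Mpoly \<psi> hp)) \<le> l2norm (Pk k (Mpoly T hp)))))
       \<and> (outer n T \<longleftrightarrow> invertible (T []) \<and> Delta n (kernel T) = cadj (T []) ** T [])
       \<and> (outer n T \<longleftrightarrow> invertible (T []) \<and>
            eK n (kernel T) = ereal (ln (Re (det (cadj (T []) ** T [])))))
       \<and> (in_F2 n f \<longrightarrow>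
            (outer n (scal f) \<longleftrightarrow> f [] \<noteq> 0 \<and> eK n (kernel (scal f)) = ereal (ln ((cmod (f []))^2))))"
proof (intro conjI impI)
  assume "in_F2 n f"
  from outer_iff_eK [OF is_op_scal [OF this]]
  show "outer n (scal f) \<longleftrightarrow> f [] \<noteq> 0 \<and> eK n (kernel (scal f)) = ereal (ln ((cmod (f []))^2))"
    unfolding det_cadj_mult_self invertible_det_nz by (simp add: det_1 scal_def)
qed (fact outer_iff_norm_trunc_maximal [OF assms] outer_iff_Delta [OF assms(2)] outer_iff_eK [OF assms(2)])+

end
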